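(* Assume the standing setting below and let $\mathbf A,\mathbf B\in\mathcal A$. The class of homomorphisms in $\mathcal A_{\mathbf A\mathbf B}$ of essential arity strictly greater than $2$ is weakly reconstructible: for every $n$ and all homomorphisms $f,g\colon\mathbf A^n\to\mathbf B$ with $\mathrm{ess}(f)>2$, $\mathrm{ess}(g)>2$ and $\mathrm{deck}(f)=\mathrm{deck}(g)$, one has $f\equiv g$.
   Context: Standing setting: $\mathbf M$ is a finite algebra, $\mathcal A=\mathbb I\mathbb S\mathbb P(\mathbf M)$ the quasivariety it generates, and some alter ego $\widetilde{\mathbf M}$ yields a logarithmic duality on $\mathcal A$. Here an alter ego $\widetilde{\mathbf M}=\langle M,G,H,R,\mathcal T_{dis}\rangle$ is a discrete topological structure on the universe of $\mathbf M$ whose total operations, partial operations and relations have graphs that are subalgebras of finite powers of $\mathbf M$ (nullary operations are constants; no other operation is constant); $\mathcal X$ is the category of structures isomorphic to closed substructures of nonempty powers of $\widetilde{\mathbf M}$, with continuous structure-preserving maps; $\mathbf A^*=\mathcal A(\mathbf A,\mathbf M)$ and $f^*(u)=u\circ f$. Logarithmic duality: all total/partial operations of $\widetilde{\mathbf M}$ are at most unary, $(\cdot)^*$ and $\mathbf X\mapsto\mathcal X(\mathbf X,\widetilde{\mathbf M})$ form a dual equivalence with $\widetilde{\mathbf M}$ injective in $\mathcal X$, and finite coproducts in $\mathcal X$ are direct unions (disjoint unions with constants amalgamated). Notation: $[n]=\{1,\dots,n\}$; for $\tau\colon[n]\to[m]$, $\tau^A(a_1,\dots,a_m)=(a_{\tau(1)},\dots,a_{\tau(n)})$;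 $g\preceq f$ iff $g=f\circ\tau^A$ for some $\tau$; $f\equiv g$ iff $f\preceq g$ and $g\preceq f$, with class $[f]$. $\mathrm{ess}(f)$ is the number of essential arguments (the $i$-th argument is essential if some $a,b\in A^n$ differing only in coordinate $i$ have $f(a)\ne f(b)$). $\mathcal A_{\mathbf A\mathbf B}=\bigcup_{n\ge1}\mathcal A(\mathbf A^n,\mathbf B)$. For $I=\{i,j\}\subseteq[n]$ with $i<j$, $\delta_I\colon[n]\to[n-1]$ is $\delta_I(k)=k$ ($k<j$), $\delta_I(j)=i$, $\delta_I(k)=k-1$ ($k>j$), and $f_I=f\circ\delta_I^A$. The deck of $f\colon A^n\to B$ is the multiset $\mathrm{deck}(f)=\{[f_I]\mid I\in\binom{[n]}{2}\}$ (classes counted with multiplicity). A class $\mathcal C$ of functions is weakly reconstructible if for every $f\in\mathcal C$ all $g\in\mathcal C$ of the same arity with $\mathrm{deck}(g)=\mathrm{deck}(f)$ satisfy $g\equiv f$. *)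

theory Defs
  imports "HOL-Analysis.Function_Topology" "HOL-Library.Multiset" "HOL-Library.FuncSet"
begin

section \<open>Algebras\<close>

text \<open>A signature is a partial map sending each of its symbols to an arity. Values of operations
  on lists of the wrong length, or with entries outside the carrier, are irrelevant.\<close>

type_synonym 'f signature = "'f \<rightharpoonup> nat"

record ('a, 'f) alg =
  carrier :: "'a set"
  oper :: "'f \<Rightarrow> 'a list \<Rightarrow> 'a"

definition tuples :: "nat \<Rightarrow> 'a set \<Rightarrow> 'a list set" where
  "tuples n X = {xs. length xs = n \<and> set xs \<subseteq> X}"

definition algebra :: "'f signature \<Rightarrow> ('a, 'f) alg \<Rightarrow> bool" where
  "algebra \<sigma> A \<longleftrightarrow> carrier A \<noteq> {} \<and>
     (\<forall>s n. \<sigma> s = Some n \<longrightarrow> (\<forall>xs \<in> tuples n (carrier A). oper A s xs \<in> carrier A))"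

definition subalgebra :: "'f signature \<Rightarrow> 'a set \<Rightarrow> ('a, 'f) alg \<Rightarrow> bool" where
  "subalgebra \<sigma> S A \<longleftrightarrow> S \<subseteq> carrier A \<and> algebra \<sigma> (A\<lparr>carrier := S\<rparr>)"

definition alg_power :: "('a, 'f) alg \<Rightarrow> 'i set \<Rightarrow> ('i \<Rightarrow> 'a, 'f) alg" where
  "alg_power A I =
     \<lparr>carrier = I \<rightarrow>\<^sub>E carrier A, oper = (\<lambda>s ts. \<lambda>i\<in>I. oper A s (map (\<lambda>t. t i) ts))\<rparr>"

definition hom :: "'f signature \<Rightarrow> ('a, 'f) alg \<Rightarrow> ('b, 'f) alg \<Rightarrow> ('a \<Rightarrow> 'b) set" where
  "hom \<sigma> A B = {\<phi> \<in> carrier A \<rightarrow>\<^sub>E carrier B. \<forall>s n. \<sigma> s = Some n \<longrightarrow>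
     (\<forall>xs \<in> tuples n (carrier A). \<phi> (oper A s xs) = oper B s (map \<phi> xs))}"

definition alg_iso :: "'f signature \<Rightarrow> ('a, 'f) alg \<Rightarrow> ('b, 'f) alg \<Rightarrow> ('a \<Rightarrow> 'b) \<Rightarrow> bool" where
  "alg_iso \<sigma> A B \<phi> \<longleftrightarrow> \<phi> \<in> hom \<sigma> A B \<and> bij_betw \<phi> (carrier A) (carrier B)"

text \<open>Membership in the class ISP(M). The exponent \<open>I\<close> may be empty. Letting it range over
  sets of type \<open>('a \<Rightarrow> 'm) set\<close> is no restriction: an algebra on \<open>'a\<close> that embeds into some power
  of \<open>M\<close> embeds into the power whose exponent is its set of homomorphisms into \<open>M\<close>.\<close>

definition in_ISP :: "'f signature \<Rightarrow> ('m, 'f) alg \<Rightarrow> ('a, 'f) alg \<Rightarrow> bool" where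
  "in_ISP \<sigma> M A \<longleftrightarrow> algebra \<sigma> A \<and>
     (\<exists>(I :: ('a \<Rightarrow> 'm) set) S \<phi>. subalgebra \<sigma> S (alg_power M I) \<and>
        alg_iso \<sigma> A ((alg_power M I)\<lparr>carrier := S\<rparr>) \<phi>)"


section \<open>Topological structures\<close>

text \<open>The partial maps give the arities of the symbols for total operations, partial operations
  and relations, respectively.\<close>

record ('g, 'h, 'r) tsignature =
  tot_ar :: "'g \<rightharpoonup> nat"
  part_ar :: "'h \<rightharpoonup> nat"
  rel_ar :: "'r \<rightharpoonup> nat"

record ('x, 'g, 'h, 'r) tstruct =
  space :: "'x topology"
  tot :: "'g \<Rightarrow> 'x list \<Rightarrow> 'x"
  part :: "'h \<Rightarrow> 'x list \<Rightarrow> 'x option"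
  rel :: "'r \<Rightarrow> 'x list set"

abbreviation points :: "('x, 'g, 'h, 'r) tstruct \<Rightarrow> 'x set" where
  "points X \<equiv> topspace (space X)"

definition closed_under_ops ::
  "('g, 'h, 'r) tsignature \<Rightarrow> ('x, 'g, 'h, 'r) tstruct \<Rightarrow> 'x set \<Rightarrow> bool" where
  "closed_under_ops \<Sigma> X S \<longleftrightarrow>
     (\<forall>g n. tot_ar \<Sigma> g = Some n \<longrightarrow> (\<forall>xs \<in> tuples n S. tot X g xs \<in> S)) \<and>
     (\<forall>h n. part_ar \<Sigma> h = Some n \<longrightarrow>
        (\<forall>xs \<in> tuples n S. \<forall>y. part X h xs = Some y \<longrightarrow> y \<in> S))"

definition is_structure :: "('g, 'h, 'r) tsignature \<Rightarrow> ('x, 'g, 'h, 'r) tstruct \<Rightarrow> bool" where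
  "is_structure \<Sigma> X \<longleftrightarrow> closed_under_ops \<Sigma> X (points X)"

text \<open>Operations and relations are only ever inspected on tuples of points, so that restricting
  the space also restricts them.\<close>

definition substruct :: "('x, 'g, 'h, 'r) tstruct \<Rightarrow> 'x set \<Rightarrow> ('x, 'g, 'h, 'r) tstruct" where
  "substruct X S = X\<lparr>space := subtopology (space X) S\<rparr>"

definition struct_power ::
  "('m, 'g, 'h, 'r) tstruct \<Rightarrow> 'i set \<Rightarrow> ('i \<Rightarrow> 'm, 'g, 'h, 'r) tstruct" where
  "struct_power X I =
     \<lparr>space = product_topology (\<lambda>_. space X) I,
      tot = (\<lambda>g ts. \<lambda>i\<in>I. tot X g (map (\<lambda>t. t i) ts)),
      part = (\<lambda>h ts. if \<forall>i\<in>I. part X h (map (\<lambda>t. t i) ts) \<noteq> None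
                     then Some (\<lambda>i\<in>I. the (part X h (map (\<lambda>t. t i) ts))) else None),
      rel = (\<lambda>r. {ts. \<forall>i\<in>I. map (\<lambda>t. t i) ts \<in> rel X r})\<rparr>"

definition mor ::
  "('g, 'h, 'r) tsignature \<Rightarrow> ('x, 'g, 'h, 'r) tstruct \<Rightarrow> ('y, 'g, 'h, 'r) tstruct
     \<Rightarrow> ('x \<Rightarrow> 'y) set" where
  "mor \<Sigma> X Y = {\<phi> \<in> points X \<rightarrow>\<^sub>E points Y. continuous_map (space X) (space Y) \<phi> \<and>
     (\<forall>g n. tot_ar \<Sigma> g = Some n \<longrightarrow>
        (\<forall>xs \<in> tuples n (points X). \<phi> (tot X g xs) = tot Y g (map \<phi> xs))) \<and>
     (\<forall>h n. part_ar \<Sigma> h = Some n \<longrightarrow>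
        (\<forall>xs \<in> tuples n (points X). \<forall>y. part X h xs = Some y \<longrightarrow>
           part Y h (map \<phi> xs) = Some (\<phi> y))) \<and>
     (\<forall>r n. rel_ar \<Sigma> r = Some n \<longrightarrow>
        (\<forall>xs \<in> tuples n (points X). xs \<in> rel X r \<longrightarrow> map \<phi> xs \<in> rel Y r))}"

definition struct_iso ::
  "('g, 'h, 'r) tsignature \<Rightarrow> ('x, 'g, 'h, 'r) tstruct \<Rightarrow> ('y, 'g, 'h, 'r) tstruct
     \<Rightarrow> ('x \<Rightarrow> 'y) \<Rightarrow> bool" where
  "struct_iso \<Sigma> X Y \<phi> \<longleftrightarrow> \<phi> \<in> mor \<Sigma> X Y \<and>
     (\<exists>\<psi> \<in> mor \<Sigma> Y X. (\<forall>x \<in> points X. \<psi> (\<phi> x) = x) \<and> (\<forall>y \<in> points Y. \<phi> (\<psi> y) = y))"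

definition closed_embedding ::
  "('g, 'h, 'r) tsignature \<Rightarrow> ('x, 'g, 'h, 'r) tstruct \<Rightarrow> ('y, 'g, 'h, 'r) tstruct
     \<Rightarrow> ('x \<Rightarrow> 'y) \<Rightarrow> bool" where
  "closed_embedding \<Sigma> X Y \<phi> \<longleftrightarrow>
     (\<exists>S. closedin (space Y) S \<and> closed_under_ops \<Sigma> Y S \<and> struct_iso \<Sigma> X (substruct Y S) \<phi>)"

text \<open>Objects of the dual category: isomorphic copies of closed substructures (possibly empty) of
  nonempty powers of the alter ego. As for \<open>in_ISP\<close>, the type of the exponent is no restriction:
  one may take the (nonempty) set of morphisms into the alter ego.\<close>

definition in_ISP_dual ::
  "('g, 'h, 'r) tsignature \<Rightarrow> ('m, 'g, 'h, 'r) tstruct \<Rightarrow> ('x, 'g, 'h, 'r) tstruct \<Rightarrow> bool" where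
  "in_ISP_dual \<Sigma> Mt X \<longleftrightarrow> is_structure \<Sigma> X \<and>
     (\<exists>(I :: ('x \<Rightarrow> 'm) set) \<phi>. I \<noteq> {} \<and> closed_embedding \<Sigma> X (struct_power Mt I) \<phi>)"


section \<open>Alter egos and duality\<close>

definition tot_graph :: "nat \<Rightarrow> 'm set \<Rightarrow> ('m list \<Rightarrow> 'm) \<Rightarrow> (nat \<Rightarrow> 'm) set" where
  "tot_graph n C g = {t \<in> {1..Suc n} \<rightarrow>\<^sub>E C. g (map t [1..<Suc n]) = t (Suc n)}"

definition part_graph :: "nat \<Rightarrow> 'm set \<Rightarrow> ('m list \<Rightarrow> 'm option) \<Rightarrow> (nat \<Rightarrow> 'm) set" where
  "part_graph n C h = {t \<in> {1..Suc n} \<rightarrow>\<^sub>E C. h (map t [1..<Suc n]) = Some (t (Suc n))}"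

definition rel_graph :: "nat \<Rightarrow> 'm set \<Rightarrow> 'm list set \<Rightarrow> (nat \<Rightarrow> 'm) set" where
  "rel_graph n C r = {t \<in> {1..n} \<rightarrow>\<^sub>E C. map t [1..<Suc n] \<in> r}"

definition alter_ego ::
  "'f signature \<Rightarrow> ('m, 'f) alg \<Rightarrow> ('g, 'h, 'r) tsignature \<Rightarrow> ('m, 'g, 'h, 'r) tstruct \<Rightarrow> bool" where
  "alter_ego \<sigma> M \<Sigma> Mt \<longleftrightarrow>
     space Mt = discrete_topology (carrier M) \<and> is_structure \<Sigma> Mt \<and>
     (\<forall>g n. tot_ar \<Sigma> g = Some n \<longrightarrow>
        subalgebra \<sigma> (tot_graph n (carrier M) (tot Mt g)) (alg_power M {1..Suc n})) \<and>
     (\<forall>h n. part_ar \<Sigma> h = Some n \<longrightarrow>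
        subalgebra \<sigma> (part_graph n (carrier M) (part Mt h)) (alg_power M {1..Suc n})) \<and>
     (\<forall>r n. rel_ar \<Sigma> r = Some n \<longrightarrow>
        subalgebra \<sigma> (rel_graph n (carrier M) (rel Mt r)) (alg_power M {1..n})) \<and>
     (\<forall>g n. tot_ar \<Sigma> g = Some n \<and> n \<ge> 1 \<longrightarrow>
        (\<exists>xs \<in> tuples n (carrier M). \<exists>ys \<in> tuples n (carrier M). tot Mt g xs \<noteq> tot Mt g ys))"

definition dual_space ::
  "'f signature \<Rightarrow> ('m, 'f) alg \<Rightarrow> ('m, 'g, 'h, 'r) tstruct \<Rightarrow> ('a, 'f) alg
     \<Rightarrow> ('a \<Rightarrow> 'm, 'g, 'h, 'r) tstruct" where
  "dual_space \<sigma> M Mt A = substruct (struct_power Mt (carrier A)) (hom \<sigma> A M)"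

definition dual_alg ::
  "('m, 'f) alg \<Rightarrow> ('g, 'h, 'r) tsignature \<Rightarrow> ('m, 'g, 'h, 'r) tstruct \<Rightarrow> ('x, 'g, 'h, 'r) tstruct
     \<Rightarrow> ('x \<Rightarrow> 'm, 'f) alg" where
  "dual_alg M \<Sigma> Mt X = (alg_power M (points X))\<lparr>carrier := mor \<Sigma> X Mt\<rparr>"

definition eval_alg :: "'f signature \<Rightarrow> ('m, 'f) alg \<Rightarrow> ('a, 'f) alg \<Rightarrow> 'a \<Rightarrow> ('a \<Rightarrow> 'm) \<Rightarrow> 'm" where
  "eval_alg \<sigma> M A = (\<lambda>a \<in> carrier A. \<lambda>u \<in> hom \<sigma> A M. u a)"

definition eval_space ::
  "('g, 'h, 'r) tsignature \<Rightarrow> ('m, 'g, 'h, 'r) tstruct \<Rightarrow> ('x, 'g, 'h, 'r) tstruct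
     \<Rightarrow> 'x \<Rightarrow> ('x \<Rightarrow> 'm) \<Rightarrow> 'm" where
  "eval_space \<Sigma> Mt X = (\<lambda>x \<in> points X. \<lambda>u \<in> mor \<Sigma> X Mt. u x)"

text \<open>HOL cannot quantify over all types inside a formula, so the two categories are taken relative
  to a universe type \<open>'u\<close>: algebras are carried by subsets of \<open>'u\<close> and structures by subsets
  of \<open>'u \<Rightarrow> 'm\<close>, the type of the dual spaces of such algebras.

  The two hom-functors are dually adjoint through the evaluation maps (which are always natural), so
  they form a dual equivalence iff all evaluation maps are isomorphisms.\<close>

definition dual_equivalence ::
  "'u itself \<Rightarrow> 'f signature \<Rightarrow> ('m, 'f) alg \<Rightarrow> ('g, 'h, 'r) tsignature
     \<Rightarrow> ('m, 'g, 'h, 'r) tstruct \<Rightarrow> bool" where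
  "dual_equivalence _ \<sigma> M \<Sigma> Mt \<longleftrightarrow>
     (\<forall>A :: ('u, 'f) alg. in_ISP \<sigma> M A \<longrightarrow>
        alg_iso \<sigma> A (dual_alg M \<Sigma> Mt (dual_space \<sigma> M Mt A)) (eval_alg \<sigma> M A)) \<and>
     (\<forall>X :: ('u \<Rightarrow> 'm, 'g, 'h, 'r) tstruct. in_ISP_dual \<Sigma> Mt X \<longrightarrow>
        struct_iso \<Sigma> X (dual_space \<sigma> M Mt (dual_alg M \<Sigma> Mt X)) (eval_space \<Sigma> Mt X))"

definition injective_alter_ego ::
  "'u itself \<Rightarrow> ('g, 'h, 'r) tsignature \<Rightarrow> ('m, 'g, 'h, 'r) tstruct \<Rightarrow> bool" where
  "injective_alter_ego _ \<Sigma> Mt \<longleftrightarrow>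
     (\<forall>(X :: ('u \<Rightarrow> 'm, 'g, 'h, 'r) tstruct) (Y :: ('u \<Rightarrow> 'm, 'g, 'h, 'r) tstruct) \<phi> \<alpha>.
        in_ISP_dual \<Sigma> Mt X \<and> in_ISP_dual \<Sigma> Mt Y \<and> closed_embedding \<Sigma> X Y \<phi> \<and> \<alpha> \<in> mor \<Sigma> X Mt
        \<longrightarrow> (\<exists>\<beta> \<in> mor \<Sigma> Y Mt. \<forall>x \<in> points X. \<beta> (\<phi> x) = \<alpha> x))"

definition is_coproduct ::
  "('g, 'h, 'r) tsignature \<Rightarrow> ('m, 'g, 'h, 'r) tstruct \<Rightarrow> nat \<Rightarrow> (nat \<Rightarrow> ('x, 'g, 'h, 'r) tstruct)
     \<Rightarrow> ('x, 'g, 'h, 'r) tstruct \<Rightarrow> (nat \<Rightarrow> 'x \<Rightarrow> 'x) \<Rightarrow> bool" where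
  "is_coproduct \<Sigma> Mt n Xs X \<iota> \<longleftrightarrow>
     in_ISP_dual \<Sigma> Mt X \<and> (\<forall>i \<in> {1..n}. \<iota> i \<in> mor \<Sigma> (Xs i) X) \<and>
     (\<forall>(Z :: ('x, 'g, 'h, 'r) tstruct) \<psi>.
        in_ISP_dual \<Sigma> Mt Z \<and> (\<forall>i \<in> {1..n}. \<psi> i \<in> mor \<Sigma> (Xs i) Z) \<longrightarrow>
        (\<exists>!\<theta>. \<theta> \<in> mor \<Sigma> X Z \<and> (\<forall>i \<in> {1..n}. \<forall>x \<in> points (Xs i). \<theta> (\<iota> i x) = \<psi> i x)))"

text \<open>The substructure generated by the nullary operations. When unary operations send constants to
  constants, this is just the set of values of the nullary operations; otherwise amalgamating the
  constants forces the amalgamation of everything they generate.\<close>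

definition constants ::
  "('g, 'h, 'r) tsignature \<Rightarrow> ('x, 'g, 'h, 'r) tstruct \<Rightarrow> 'x set" where
  "constants \<Sigma> X = \<Inter>{S. S \<subseteq> points X \<and> closed_under_ops \<Sigma> X S}"

text \<open>\<open>X\<close> is the union of copies of \<open>Xs 1, \<dots>, Xs n\<close> meeting pairwise in the constants, with
  the final topology; domains of partial operations and relations are the unions of those of the
  copies. Only meant for operations of arity at most one, where total operations and values
  of partial operations are then determined by the \<open>\<iota> i\<close> being morphisms.\<close>

definition is_direct_union ::
  "('g, 'h, 'r) tsignature \<Rightarrow> nat \<Rightarrow> (nat \<Rightarrow> ('x, 'g, 'h, 'r) tstruct)
     \<Rightarrow> ('x, 'g, 'h, 'r) tstruct \<Rightarrow> (nat \<Rightarrow> 'x \<Rightarrow> 'x) \<Rightarrow> bool" where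
  "is_direct_union \<Sigma> n Xs X \<iota> \<longleftrightarrow>
     (\<forall>i \<in> {1..n}. \<iota> i \<in> mor \<Sigma> (Xs i) X \<and> inj_on (\<iota> i) (points (Xs i))) \<and>
     points X = (\<Union>i \<in> {1..n}. \<iota> i ` points (Xs i)) \<and>
     (\<forall>i \<in> {1..n}. \<forall>j \<in> {1..n}. i \<noteq> j \<longrightarrow>
        \<iota> i ` points (Xs i) \<inter> \<iota> j ` points (Xs j) = constants \<Sigma> X) \<and>
     (\<forall>U \<subseteq> points X. openin (space X) U \<longleftrightarrow>
        (\<forall>i \<in> {1..n}. openin (space (Xs i)) {x \<in> points (Xs i). \<iota> i x \<in> U})) \<and>
     (\<forall>h k. part_ar \<Sigma> h = Some k \<longrightarrow>
        {xs \<in> tuples k (points X). part X h xs \<noteq> None} =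
        (\<Union>i \<in> {1..n}. map (\<iota> i) ` {xs \<in> tuples k (points (Xs i)). part (Xs i) h xs \<noteq> None})) \<and>
     (\<forall>r k. rel_ar \<Sigma> r = Some k \<longrightarrow>
        tuples k (points X) \<inter> rel X r =
        (\<Union>i \<in> {1..n}. map (\<iota> i) ` (tuples k (points (Xs i)) \<inter> rel (Xs i) r)))"

definition logarithmic_duality ::
  "'u itself \<Rightarrow> 'f signature \<Rightarrow> ('m, 'f) alg \<Rightarrow> ('g, 'h, 'r) tsignature
     \<Rightarrow> ('m, 'g, 'h, 'r) tstruct \<Rightarrow> bool" where
  "logarithmic_duality U \<sigma> M \<Sigma> Mt \<longleftrightarrow>
     (\<forall>g n. tot_ar \<Sigma> g = Some n \<longrightarrow> n \<le> 1) \<and>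
     (\<forall>h n. part_ar \<Sigma> h = Some n \<longrightarrow> n \<le> 1) \<and>
     dual_equivalence U \<sigma> M \<Sigma> Mt \<and>
     injective_alter_ego U \<Sigma> Mt \<and>
     (\<forall>n \<ge> 1. \<forall>(Xs :: nat \<Rightarrow> ('u \<Rightarrow> 'm, 'g, 'h, 'r) tstruct) X \<iota>.
        (\<forall>i \<in> {1..n}. in_ISP_dual \<Sigma> Mt (Xs i)) \<and> is_coproduct \<Sigma> Mt n Xs X \<iota>
        \<longrightarrow> is_direct_union \<Sigma> n Xs X \<iota>)"


section \<open>Minors and decks\<close>

text \<open>An \<open>n\<close>-ary function from \<open>A\<close> to \<open>B\<close> is an element of \<open>({1..n} \<rightarrow>\<^sub>E A) \<rightarrow>\<^sub>E B\<close>, paired with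
  its arity \<open>n\<close>.\<close>

type_synonym ('a, 'b) func = "nat \<times> ((nat \<Rightarrow> 'a) \<Rightarrow> 'b)"

definition funcs :: "'a set \<Rightarrow> 'b set \<Rightarrow> ('a, 'b) func set" where
  "funcs A B = {(n, f). n \<ge> 1 \<and> f \<in> ({1..n} \<rightarrow>\<^sub>E A) \<rightarrow>\<^sub>E B}"

text \<open>For \<open>\<tau>: {1..n} \<rightarrow> {1..m}\<close> and an \<open>n\<close>-ary \<open>f\<close>, the \<open>m\<close>-ary function sending \<open>a\<close> to
  the value of \<open>f\<close> at \<open>(a (\<tau> 1), \<dots>, a (\<tau> n))\<close>.\<close>

definition minor :: "'a set \<Rightarrow> nat \<Rightarrow> (nat \<Rightarrow> nat) \<Rightarrow> ('a, 'b) func \<Rightarrow> ('a, 'b) func" where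
  "minor A m \<tau> F = (m, \<lambda>a \<in> {1..m} \<rightarrow>\<^sub>E A. snd F (\<lambda>i \<in> {1..fst F}. a (\<tau> i)))"

definition is_minor :: "'a set \<Rightarrow> ('a, 'b) func \<Rightarrow> ('a, 'b) func \<Rightarrow> bool" where
  "is_minor A G F \<longleftrightarrow> (\<exists>\<tau> \<in> {1..fst F} \<rightarrow> {1..fst G}. G = minor A (fst G) \<tau> F)"

definition func_equiv :: "'a set \<Rightarrow> ('a, 'b) func \<Rightarrow> ('a, 'b) func \<Rightarrow> bool" where
  "func_equiv A F G \<longleftrightarrow> is_minor A F G \<and> is_minor A G F"

definition func_class :: "'a set \<Rightarrow> 'b set \<Rightarrow> ('a, 'b) func \<Rightarrow> ('a, 'b) func set" where
  "func_class A B F = {G \<in> funcs A B. func_equiv A G F}"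

definition essential :: "'a set \<Rightarrow> ('a, 'b) func \<Rightarrow> nat \<Rightarrow> bool" where
  "essential A F i \<longleftrightarrow> (\<exists>a \<in> {1..fst F} \<rightarrow>\<^sub>E A. \<exists>b \<in> {1..fst F} \<rightarrow>\<^sub>E A.
     (\<forall>k \<in> {1..fst F} - {i}. a k = b k) \<and> snd F a \<noteq> snd F b)"

definition ess :: "'a set \<Rightarrow> ('a, 'b) func \<Rightarrow> nat" where
  "ess A F = card {i \<in> {1..fst F}. essential A F i}"

definition delta :: "nat set \<Rightarrow> nat \<Rightarrow> nat" where
  "delta I k = (if k < Max I then k else if k = Max I then Min I else k - 1)"

definition deck :: "'a set \<Rightarrow> 'b set \<Rightarrow> ('a, 'b) func \<Rightarrow> ('a, 'b) func set multiset" where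
  "deck A B F = image_mset (\<lambda>I. func_class A B (minor A (fst F - 1) (delta I) F))
     (mset_set {I. I \<subseteq> {1..fst F} \<and> card I = 2})"

definition weakly_reconstructible :: "'a set \<Rightarrow> 'b set \<Rightarrow> ('a, 'b) func set \<Rightarrow> bool" where
  "weakly_reconstructible A B C \<longleftrightarrow>
     (\<forall>F \<in> C. \<forall>G \<in> C. fst G = fst F \<and> deck A B G = deck A B F \<longrightarrow> func_equiv A G F)"

definition hom_funcs :: "'f signature \<Rightarrow> ('a, 'f) alg \<Rightarrow> ('b, 'f) alg \<Rightarrow> ('a, 'b) func set" where
  "hom_funcs \<sigma> A B = {(n, f). n \<ge> 1 \<and> f \<in> hom \<sigma> (alg_power A {1..n}) B}"

end

theory Submission
  imports Defs
begin

text \<open>The only use of the duality: since the dual of \<open>A\<^sup>n\<close> is the \<open>n\<close>-th copower of the dual of \<open>A\<close>, hence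
  a direct union of copies of it, every homomorphism \<open>A\<^sup>n \<rightarrow> M\<close> factors through a projection. So for
  \<open>f: A\<^sup>n \<rightarrow> B\<close> and \<open>u: B \<rightarrow> M\<close> there is \<open>i\<close> with \<open>u (f a) = u (d (a i))\<close>, where \<open>d x = f (x, \<dots>, x)\<close>
  is unchanged by taking minors; \<open>i\<close> is unique unless \<open>u \<circ> d\<close> is constant. As the maps \<open>u\<close> separate
  the points of \<open>B\<close>, the class of \<open>f\<close> is determined by \<open>d\<close> and by the equivalence relation identifying
  those \<open>u\<close> that read the same coordinate. Taking \<open>f\<^sub>I\<close> merges the two classes indexed by \<open>I\<close>, so for
  \<open>n \<ge> 3\<close> this relation is the intersection of the relations of the cards.\<close>

text \<open>The duality says that whatever is a coproduct is a direct union. That the dual of A^n,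
  with the duals of the projections, is a coproduct has to be derived from the evaluation
  isomorphisms, and for this the hom-sets must be shown to be objects of the dual category.
  Moreover, the duality speaks only of algebras on the type \<open>'u\<close>, while A^n lives on
  \<open>nat => 'u\<close>. Infiniteness of \<open>'u\<close> lets A^n be copied into
  \<open>'u\<close>, and the coproduct argument is stated for any algebra \<open>P\<close> that is a
  product of copies of A along maps \<open>pr i\<close>. In the combinatorial half, three arguments
  provide, for distinct i and i', a third index k: the card merging i and k still keeps i and i'
  apart. Maps u with u o d constant read every coordinate equally well, so they are set aside when
  arguments of f are matched with those of g.\<close>

section \<open>Finitely many maps into a discrete space\<close>

lemma openin_finitely_many_discrete_maps:
  assumes "\<forall>w \<in> set ws. continuous_map T (discrete_topology C) w"
  shows "openin T {z \<in> topspace T. P (map (\<lambda>w. w z) ws)}"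
  using assms
proof (induction ws arbitrary: P)
  case Nil
  then show ?case by (cases "P []") auto
next
  case (Cons w ws)
  have w: "continuous_map T (discrete_topology C) w" using Cons.prems by simp
  \<comment> \<open>Splitting by the value \<open>c\<close> of the first map leaves a predicate on
    the remaining values, so the induction hypothesis is needed for arbitrary
    \<open>P\<close>.\<close>
  have "{z \<in> topspace T. P (map (\<lambda>w. w z) (w # ws))} =
    (\<Union>c \<in> C. {z \<in> topspace T. w z \<in> {c}} \<inter> {z \<in> topspace T. P (c # map (\<lambda>w. w z) ws)})"
    using continuous_map_image_subset_topspace[OF w] by auto
  moreover have "openin T {z \<in> topspace T. w z \<in> {c}}" if "c \<in> C" for c
    using that by (intro openin_continuous_map_preimage[OF w]) auto
  moreover have "openin T {z \<in> topspace T. P (c # map (\<lambda>w. w z) ws)}" for c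
    using Cons.IH[of "\<lambda>xs. P (c # xs)"] Cons.prems by simp
  ultimately show ?case by (simp only:) (intro openin_Union; blast)
qed

lemma continuous_map_finitely_many_discrete_maps:
  assumes "\<forall>w \<in> set ws. continuous_map T (discrete_topology C) w"
    and "\<And>z. z \<in> topspace T \<Longrightarrow> F (map (\<lambda>w. w z) ws) \<in> C"
  shows "continuous_map T (discrete_topology C) (\<lambda>z. F (map (\<lambda>w. w z) ws))"
  unfolding continuous_map_def
  using assms(2) openin_finitely_many_discrete_maps[OF assms(1)] by auto

section \<open>Algebras\<close>

lemma algebra_oper:
  assumes "algebra \<sigma> A" "\<sigma> s = Some n" "xs \<in> tuples n (carrier A)"
  shows "oper A s xs \<in> carrier A"
  using assms by (auto simp: algebra_def)

lemma algebra_opers: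
  "algebra \<sigma> A \<Longrightarrow>
    \<forall>s n. \<sigma> s = Some n \<longrightarrow> (\<forall>xs \<in> tuples n (carrier A). oper A s xs \<in> carrier A)"
  by (simp add: algebra_def)

lemma homI:
  assumes "\<phi> \<in> carrier A \<rightarrow>\<^sub>E carrier B"
    and "\<And>s n xs. \<sigma> s = Some n \<Longrightarrow> xs \<in> tuples n (carrier A) \<Longrightarrow>
      \<phi> (oper A s xs) = oper B s (map \<phi> xs)"
  shows "\<phi> \<in> hom \<sigma> A B"
  using assms by (simp add: hom_def)

lemma hom_PiE: "\<phi> \<in> hom \<sigma> A B \<Longrightarrow> \<phi> \<in> carrier A \<rightarrow>\<^sub>E carrier B"
  by (simp add: hom_def)

lemma hom_closed: "\<phi> \<in> hom \<sigma> A B \<Longrightarrow> a \<in> carrier A \<Longrightarrow> \<phi> a \<in> carrier B"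
  by (auto simp: hom_def)

lemma hom_oper:
  "\<phi> \<in> hom \<sigma> A B \<Longrightarrow> \<sigma> s = Some n \<Longrightarrow> xs \<in> tuples n (carrier A) \<Longrightarrow>
    \<phi> (oper A s xs) = oper B s (map \<phi> xs)"
  by (auto simp: hom_def)

text \<open>Only closure under the operations is asked of \<open>A\<close>, since
  \<open>algebra\<close> would also demand a nonempty carrier: through \<open>mor_dual\<close> this
  is applied to an algebra of morphisms \<open>dual_alg M \<Sigma> Mt Z\<close>, for which just
  closure is proved.\<close>

lemma hom_compose:
  assumes "\<forall>s n. \<sigma> s = Some n \<longrightarrow> (\<forall>xs \<in> tuples n (carrier A). oper A s xs \<in> carrier A)"
    and "\<phi> \<in> hom \<sigma> A B" "\<psi> \<in> hom \<sigma> B D"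
  shows "(\<lambda>a \<in> carrier A. \<psi> (\<phi> a)) \<in> hom \<sigma> A D"
proof (rule homI)
  show "(\<lambda>a \<in> carrier A. \<psi> (\<phi> a)) \<in> carrier A \<rightarrow>\<^sub>E carrier D"
    using assms(2,3) by (auto intro: hom_closed)
next
  fix s n xs assume s: "\<sigma> s = Some n" and xs: "xs \<in> tuples n (carrier A)"
  have "map \<phi> xs \<in> tuples n (carrier B)"
    using xs hom_closed[OF assms(2)] by (auto simp: tuples_def)
  then have "\<psi> (\<phi> (oper A s xs)) = oper D s (map (\<lambda>a. \<psi> (\<phi> a)) xs)"
    using hom_oper[OF assms(2) s xs] hom_oper[OF assms(3) s] by (simp add: comp_def)
  moreover have eq: "map (\<lambda>a \<in> carrier A. \<psi> (\<phi> a)) xs = map (\<lambda>a. \<psi> (\<phi> a)) xs"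
    using xs by (auto simp: tuples_def)
  ultimately show "(\<lambda>a \<in> carrier A. \<psi> (\<phi> a)) (oper A s xs) =
      oper D s (map (\<lambda>a \<in> carrier A. \<psi> (\<phi> a)) xs)"
    using assms(1) s xs by (simp add: eq)
qed

lemma algebra_alg_power:
  assumes A: "algebra \<sigma> A"
  shows "algebra \<sigma> (alg_power A I)"
  unfolding algebra_def
proof (intro conjI allI impI ballI)
  show "carrier (alg_power A I) \<noteq> {}"
    using A by (simp add: algebra_def alg_power_def PiE_eq_empty_iff)
  fix s n ts assume s: "\<sigma> s = Some n" and ts: "ts \<in> tuples n (carrier (alg_power A I))"
  have "oper A s (map (\<lambda>t. t i) ts) \<in> carrier A" if "i \<in> I" for i
    using ts that by (intro algebra_oper[OF A s]) (fastforce simp: tuples_def alg_power_def)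
  then show "oper (alg_power A I) s ts \<in> carrier (alg_power A I)" by (auto simp: alg_power_def)
qed

lemma in_ISP_algebra: "in_ISP \<sigma> M A \<Longrightarrow> algebra \<sigma> A"
  by (simp add: in_ISP_def)

text \<open>The coordinates of an embedding into a power of \<open>M\<close> are homomorphisms into
  \<open>M\<close>, and two elements that agree under all of them have the same image.\<close>

lemma in_ISP_separates:
  fixes A :: "('a, 'f) alg" and M :: "('b, 'f) alg"
  assumes "in_ISP \<sigma> M A" "a \<in> carrier A" "b \<in> carrier A"
    and eq: "\<And>u. u \<in> hom \<sigma> A M \<Longrightarrow> u a = u b"
  shows "a = b"
proof -
  obtain I :: "('a \<Rightarrow> 'b) set" and S \<phi> where S: "subalgebra \<sigma> S (alg_power M I)"
    and \<phi>: "alg_iso \<sigma> A ((alg_power M I)\<lparr>carrier := S\<rparr>) \<phi>"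
    using assms(1) by (auto simp: in_ISP_def)
  have alg: "algebra \<sigma> A" using assms(1) by (rule in_ISP_algebra)
  have h: "\<phi> \<in> hom \<sigma> A ((alg_power M I)\<lparr>carrier := S\<rparr>)" and inj: "inj_on \<phi> (carrier A)"
    using \<phi> by (auto simp: alg_iso_def bij_betw_def)
  have SI: "S \<subseteq> I \<rightarrow>\<^sub>E carrier M" using S by (simp add: subalgebra_def alg_power_def)
  have mem: "\<phi> x \<in> I \<rightarrow>\<^sub>E carrier M" if "x \<in> carrier A" for x
    using hom_closed[OF h that] SI by auto
  have "\<phi> a i = \<phi> b i" if i: "i \<in> I" for i
  proof -
    have "(\<lambda>x \<in> carrier A. \<phi> x i) \<in> hom \<sigma> A M"
    proof (rule homI)
      show "(\<lambda>x \<in> carrier A. \<phi> x i) \<in> carrier A \<rightarrow>\<^sub>E carrier M" using mem i by auto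
    next
      fix s n xs assume s: "\<sigma> s = Some n" and xs: "xs \<in> tuples n (carrier A)"
      have eq: "map (\<lambda>x \<in> carrier A. \<phi> x i) xs = map (\<lambda>x. \<phi> x i) xs"
        using xs by (auto simp: tuples_def)
      show "(\<lambda>x \<in> carrier A. \<phi> x i) (oper A s xs) = oper M s (map (\<lambda>x \<in> carrier A. \<phi> x i) xs)"
        using hom_oper[OF h s xs] algebra_oper[OF alg s xs] i
        by (simp add: alg_power_def comp_def eq)
    qed
    from eq[OF this] show ?thesis using assms(2,3) by simp
  qed
  then have "\<phi> a = \<phi> b"
    using mem[OF assms(2)] mem[OF assms(3)] by (auto intro: PiE_ext)
  then show ?thesis using inj assms(2,3) by (auto dest: inj_onD)
qed

text \<open>Evaluation at all homomorphisms embeds \<open>A\<close> into the power of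
  \<open>M\<close> with exponent \<open>hom \<sigma> A M\<close>, a set of exactly the type that
  \<open>in_ISP\<close> quantifies over. It serves to place a copy of A^n in the
  quasivariety.\<close>

lemma in_ISP_if_separates:
  fixes A :: "('a, 'f) alg"
  assumes alg: "algebra \<sigma> A"
    and sep: "\<And>a b. a \<in> carrier A \<Longrightarrow> b \<in> carrier A \<Longrightarrow>
      (\<And>u. u \<in> hom \<sigma> A M \<Longrightarrow> u a = u b) \<Longrightarrow> a = b"
  shows "in_ISP \<sigma> M A"
proof -
  define I where "I = hom \<sigma> A M"
  define \<phi> where "\<phi> = (\<lambda>a \<in> carrier A. \<lambda>u \<in> I. u a)"
  define S where "S = \<phi> ` carrier A"
  have op: "\<phi> (oper A s xs) = oper (alg_power M I) s (map \<phi> xs)"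
    if s: "\<sigma> s = Some n" and xs: "xs \<in> tuples n (carrier A)" for s n xs
  proof
    fix u
    have eq: "map ((\<lambda>t. t u) \<circ> \<phi>) xs = map u xs" if "u \<in> I"
      using xs that by (auto simp: \<phi>_def tuples_def)
    have "\<phi> (oper A s xs) = (\<lambda>u \<in> I. u (oper A s xs))"
      using algebra_oper[OF alg s xs] by (simp add: \<phi>_def)
    then show "\<phi> (oper A s xs) u = oper (alg_power M I) s (map \<phi> xs) u"
      using hom_oper[of u \<sigma> A M, OF _ s xs]
      by (simp add: alg_power_def eq) (simp add: I_def)
  qed
  have hom: "\<phi> \<in> hom \<sigma> A ((alg_power M I)\<lparr>carrier := S\<rparr>)"
    using op by (intro homI) (auto simp: S_def \<phi>_def)
  have "algebra \<sigma> ((alg_power M I)\<lparr>carrier := S\<rparr>)"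
    unfolding algebra_def
  proof (intro conjI allI impI ballI)
    show "carrier ((alg_power M I)\<lparr>carrier := S\<rparr>) \<noteq> {}"
      using alg by (simp add: S_def algebra_def)
  next
    fix s n ts assume s: "\<sigma> s = Some n"
      and "ts \<in> tuples n (carrier ((alg_power M I)\<lparr>carrier := S\<rparr>))"
    then have "ts \<in> lists (\<phi> ` carrier A)" and l: "length ts = n"
      by (auto simp: tuples_def S_def)
    then obtain xs where xs: "ts = map \<phi> xs" "set xs \<subseteq> carrier A"
      by (auto simp: lists_image)
    then have "xs \<in> tuples n (carrier A)" using l by (auto simp: tuples_def)
    from op[OF s this] algebra_oper[OF alg s this]
    show "oper ((alg_power M I)\<lparr>carrier := S\<rparr>) s ts \<in> carrier ((alg_power M I)\<lparr>carrier := S\<rparr>)"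
      by (auto simp: S_def xs(1) intro: image_eqI[OF sym])
  qed
  moreover have "S \<subseteq> carrier (alg_power M I)"
    by (auto simp: S_def \<phi>_def I_def alg_power_def intro: hom_closed)
  ultimately have "subalgebra \<sigma> S (alg_power M I)" by (simp add: subalgebra_def)
  moreover have "inj_on \<phi> (carrier A)"
  proof (rule inj_onI)
    fix a b assume ab: "a \<in> carrier A" "b \<in> carrier A" "\<phi> a = \<phi> b"
    show "a = b"
    proof (rule sep[OF ab(1,2)])
      fix u assume "u \<in> hom \<sigma> A M"
      then show "u a = u b" using fun_cong[OF ab(3), of u] ab(1,2) by (simp add: \<phi>_def I_def)
    qed
  qed
  then have "alg_iso \<sigma> A ((alg_power M I)\<lparr>carrier := S\<rparr>) \<phi>"
    using hom by (simp add: alg_iso_def bij_betw_def S_def)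
  ultimately show ?thesis using alg unfolding in_ISP_def by blast
qed

section \<open>Structures\<close>

lemma points_substruct [simp]: "points (substruct X S) = points X \<inter> S"
  by (simp add: substruct_def)

lemma substruct_simps [simp]:
  "tot (substruct X S) = tot X" "part (substruct X S) = part X" "rel (substruct X S) = rel X"
  "space (substruct X S) = subtopology (space X) S"
  by (simp_all add: substruct_def)

lemma points_struct_power [simp]: "points (struct_power X I) = I \<rightarrow>\<^sub>E points X"
  by (simp add: struct_power_def)

lemma morI:
  assumes "\<phi> \<in> points X \<rightarrow>\<^sub>E points Y" "continuous_map (space X) (space Y) \<phi>"
    and "\<And>g n xs. tot_ar \<Sigma> g = Some n \<Longrightarrow> xs \<in> tuples n (points X) \<Longrightarrow>
      \<phi> (tot X g xs) = tot Y g (map \<phi> xs)"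
    and "\<And>h n xs y. part_ar \<Sigma> h = Some n \<Longrightarrow> xs \<in> tuples n (points X) \<Longrightarrow> part X h xs = Some y \<Longrightarrow>
      part Y h (map \<phi> xs) = Some (\<phi> y)"
    and "\<And>r n xs. rel_ar \<Sigma> r = Some n \<Longrightarrow> xs \<in> tuples n (points X) \<Longrightarrow> xs \<in> rel X r \<Longrightarrow>
      map \<phi> xs \<in> rel Y r"
  shows "\<phi> \<in> mor \<Sigma> X Y"
  using assms by (simp add: mor_def)

lemma morD:
  assumes "\<phi> \<in> mor \<Sigma> X Y"
  shows "\<phi> \<in> points X \<rightarrow>\<^sub>E points Y" "continuous_map (space X) (space Y) \<phi>"
    and "tot_ar \<Sigma> g = Some n \<Longrightarrow> xs \<in> tuples n (points X) \<Longrightarrow>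
      \<phi> (tot X g xs) = tot Y g (map \<phi> xs)"
    and "part_ar \<Sigma> h = Some n \<Longrightarrow> xs \<in> tuples n (points X) \<Longrightarrow> part X h xs = Some y \<Longrightarrow>
      part Y h (map \<phi> xs) = Some (\<phi> y)"
    and "rel_ar \<Sigma> r = Some n \<Longrightarrow> xs \<in> tuples n (points X) \<Longrightarrow> xs \<in> rel X r \<Longrightarrow>
      map \<phi> xs \<in> rel Y r"
    and "x \<in> points X \<Longrightarrow> \<phi> x \<in> points Y"
  using assms by (auto simp: mor_def)

lemma closed_under_opsD:
  assumes "closed_under_ops \<Sigma> X S"
  shows "tot_ar \<Sigma> g = Some n \<Longrightarrow> xs \<in> tuples n S \<Longrightarrow> tot X g xs \<in> S"
    and "part_ar \<Sigma> h = Some n \<Longrightarrow> xs \<in> tuples n S \<Longrightarrow> part X h xs = Some y \<Longrightarrow> y \<in> S"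
  using assms by (auto simp: closed_under_ops_def)

lemma is_structure_substruct:
  assumes "closed_under_ops \<Sigma> X S" "S \<subseteq> points X"
  shows "is_structure \<Sigma> (substruct X S)"
  using assms by (auto simp: is_structure_def closed_under_ops_def inf.absorb2)

lemma mor_compose:
  assumes "is_structure \<Sigma> X" "\<phi> \<in> mor \<Sigma> X Y" "\<psi> \<in> mor \<Sigma> Y Z"
  shows "(\<lambda>x \<in> points X. \<psi> (\<phi> x)) \<in> mor \<Sigma> X Z"
proof (rule morI)
  note cl = closed_under_opsD[OF assms(1)[unfolded is_structure_def]]
  have tup: "map \<phi> xs \<in> tuples n (points Y)" if "xs \<in> tuples n (points X)" for xs n
    using that morD(6)[OF assms(2)] by (auto simp: tuples_def)
  have eq: "map (\<lambda>x \<in> points X. \<psi> (\<phi> x)) xs = map \<psi> (map \<phi> xs)"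
    if "xs \<in> tuples n (points X)" for xs n
    using that by (auto simp: tuples_def)
  show "(\<lambda>x \<in> points X. \<psi> (\<phi> x)) \<in> points X \<rightarrow>\<^sub>E points Z"
    using morD(6)[OF assms(2)] morD(6)[OF assms(3)] by auto
  have "continuous_map (space X) (space Z) (\<psi> \<circ> \<phi>)"
    using morD(2)[OF assms(2)] morD(2)[OF assms(3)] by (rule continuous_map_compose)
  then show "continuous_map (space X) (space Z) (\<lambda>x \<in> points X. \<psi> (\<phi> x))"
    by (rule continuous_map_eq) simp
  show "(\<lambda>x \<in> points X. \<psi> (\<phi> x)) (tot X g xs) = tot Z g (map (\<lambda>x \<in> points X. \<psi> (\<phi> x)) xs)"
    if "tot_ar \<Sigma> g = Some n" "xs \<in> tuples n (points X)" for g n xs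
    using cl(1)[OF that] morD(3)[OF assms(2) that] morD(3)[OF assms(3) that(1) tup[OF that(2)]]
    by (simp add: eq[OF that(2)])
  show "part Z h (map (\<lambda>x \<in> points X. \<psi> (\<phi> x)) xs) = Some ((\<lambda>x \<in> points X. \<psi> (\<phi> x)) y)"
    if "part_ar \<Sigma> h = Some n" "xs \<in> tuples n (points X)" "part X h xs = Some y" for h n xs y
    using cl(2)[OF that] morD(4)[OF assms(2) that]
      morD(4)[OF assms(3) that(1) tup[OF that(2)] morD(4)[OF assms(2) that]]
    by (simp add: eq[OF that(2)])
  show "map (\<lambda>x \<in> points X. \<psi> (\<phi> x)) xs \<in> rel Z r"
    if "rel_ar \<Sigma> r = Some n" "xs \<in> tuples n (points X)" "xs \<in> rel X r" for r n xs
    using morD(5)[OF assms(3) that(1) tup[OF that(2)] morD(5)[OF assms(2) that]]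
    by (simp add: eq[OF that(2)])
qed

lemma is_structure_struct_power:
  assumes "is_structure \<Sigma> X"
  shows "is_structure \<Sigma> (struct_power X I)"
proof -
  note cl = closed_under_opsD[OF assms[unfolded is_structure_def]]
  have tup: "map (\<lambda>t. t i) ts \<in> tuples n (points X)"
    if "ts \<in> tuples n (I \<rightarrow>\<^sub>E points X)" "i \<in> I" for ts n i
    using that by (fastforce simp: tuples_def)
  show ?thesis
    unfolding is_structure_def closed_under_ops_def points_struct_power
  proof (intro conjI allI impI ballI)
    fix g n ts assume "tot_ar \<Sigma> g = Some n" "ts \<in> tuples n (I \<rightarrow>\<^sub>E points X)"
    then show "tot (struct_power X I) g ts \<in> I \<rightarrow>\<^sub>E points X"
      using cl(1) tup by (auto simp: struct_power_def)
  next
    fix h n ts y assume "part_ar \<Sigma> h = Some n" "ts \<in> tuples n (I \<rightarrow>\<^sub>E points X)"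
      "part (struct_power X I) h ts = Some y"
    then show "y \<in> I \<rightarrow>\<^sub>E points X"
      using cl(2) tup by (force simp: struct_power_def split: if_splits)
  qed
qed

text \<open>All structure on a power is pointwise, so precomposing with a map of index sets respects
  it. There are two uses: with a bijection \<open>\<rho>\<close> it changes the exponent of a power,
  and with a homomorphism \<open>\<rho>\<close> it is the source of the dual map.\<close>

lemma mor_reindex_power:
  assumes str: "is_structure \<Sigma> X" and "\<rho> \<in> J \<rightarrow> I"
  shows "(\<lambda>t \<in> I \<rightarrow>\<^sub>E points X. \<lambda>j \<in> J. t (\<rho> j)) \<in> mor \<Sigma> (struct_power X I) (struct_power X J)"
    (is "?R \<in> _")
proof (rule morI)
  have \<rho>: "\<rho> j \<in> I" if "j \<in> J" for j using assms that by auto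
  have mp: "map (\<lambda>t. t j) (map ?R ts) = map (\<lambda>t. t (\<rho> j)) ts"
    if "ts \<in> tuples n (points (struct_power X I))" "j \<in> J" for ts n j
    using that by (auto simp: tuples_def)
  show "?R \<in> points (struct_power X I) \<rightarrow>\<^sub>E points (struct_power X J)"
    using \<rho> by (auto simp: PiE_iff)
  have "continuous_map (product_topology (\<lambda>_. space X) I) (product_topology (\<lambda>_. space X) J)
      (\<lambda>t. \<lambda>j \<in> J. t (\<rho> j))"
    unfolding continuous_map_componentwise
  proof (intro conjI ballI)
    fix j assume j: "j \<in> J"
    have "continuous_map (product_topology (\<lambda>_. space X) I) (space X) (\<lambda>t. t (\<rho> j))"
      using \<rho>[OF j] by (rule continuous_map_product_projection)
    then show "continuous_map (product_topology (\<lambda>_. space X) I) (space X) (\<lambda>t. (\<lambda>j \<in> J. t (\<rho> j)) j)"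
      using j by simp
  qed auto
  then have "continuous_map (product_topology (\<lambda>_. space X) I) (product_topology (\<lambda>_. space X) J) ?R"
    by (rule continuous_map_eq) auto
  then show "continuous_map (space (struct_power X I)) (space (struct_power X J)) ?R"
    by (simp add: struct_power_def)
  show "map ?R ts \<in> rel (struct_power X J) r"
    if r: "rel_ar \<Sigma> r = Some n" and ts: "ts \<in> tuples n (points (struct_power X I))"
      and tsr: "ts \<in> rel (struct_power X I) r" for r n ts
  proof -
    have "map (\<lambda>t. t j) (map ?R ts) \<in> rel X r" if j: "j \<in> J" for j
      using tsr \<rho>[OF j] by (simp only: mp[OF ts j]) (simp add: struct_power_def)
    then show ?thesis by (simp add: struct_power_def)
  qed
  show "?R (tot (struct_power X I) g ts) = tot (struct_power X J) g (map ?R ts)"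
    if "tot_ar \<Sigma> g = Some n" "ts \<in> tuples n (points (struct_power X I))" for g n ts
  proof -
    have "tot (struct_power X I) g ts \<in> I \<rightarrow>\<^sub>E points X"
      using closed_under_opsD(1)[OF is_structure_struct_power[OF str, unfolded is_structure_def] that]
      by simp
    then have "?R (tot (struct_power X I) g ts) = (\<lambda>j \<in> J. tot X g (map (\<lambda>t. t (\<rho> j)) ts))"
      using \<rho> by (auto simp: struct_power_def)
    also have "\<dots> = (\<lambda>j \<in> J. tot X g (map (\<lambda>t. t j) (map ?R ts)))"
      by (intro restrict_ext arg_cong[where f = "tot X g"] mp[OF that(2), symmetric])
    finally show ?thesis by (simp add: struct_power_def)
  qed
  show "part (struct_power X J) h (map ?R ts) = Some (?R y)"
    if "part_ar \<Sigma> h = Some n" "ts \<in> tuples n (points (struct_power X I))"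
      "part (struct_power X I) h ts = Some y" for h n ts y
  proof -
    have "y \<in> I \<rightarrow>\<^sub>E points X"
      using closed_under_opsD(2)[OF is_structure_struct_power[OF str, unfolded is_structure_def] that]
      by simp
    moreover have def: "\<forall>i \<in> I. part X h (map (\<lambda>t. t i) ts) \<noteq> None"
      and y: "y = (\<lambda>i \<in> I. the (part X h (map (\<lambda>t. t i) ts)))"
      using that(3) by (auto simp: struct_power_def split: if_splits)
    ultimately have "?R y = (\<lambda>j \<in> J. the (part X h (map (\<lambda>t. t (\<rho> j)) ts)))"
      using \<rho> by auto
    also have "\<dots> = (\<lambda>j \<in> J. the (part X h (map (\<lambda>t. t j) (map ?R ts))))"
      by (intro restrict_ext arg_cong[where f = "\<lambda>ts. the (part X h ts)"] mp[OF that(2), symmetric])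
    finally have "?R y = \<dots>" .
    moreover have "\<forall>j \<in> J. part X h (map (\<lambda>t. t j) (map ?R ts)) \<noteq> None"
    proof
      fix j assume j: "j \<in> J"
      show "part X h (map (\<lambda>t. t j) (map ?R ts)) \<noteq> None"
        using def \<rho>[OF j] unfolding mp[OF that(2) j] by blast
    qed
    ultimately show ?thesis by (simp add: struct_power_def)
  qed
qed

section \<open>Operations of \<open>M\<close> commute with the structure of the alter ego\<close>

text \<open>\<open>F u x\<close> is a matrix with rows indexed by \<open>us\<close> and columns by
  \<open>xs\<close>. Its columns are tuples in \<open>R\<close>, which form a subalgebra, and
  applying \<open>s\<close> to the columns coordinatewise means applying \<open>s\<close> along
  every row.\<close>

lemma rel_graph_oper:
  assumes "subalgebra \<sigma> (rel_graph N (carrier M) R) (alg_power M {1..N})"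
    and s: "\<sigma> s = Some (length xs)" and us: "length us = N"
    and F: "\<And>u x. u \<in> set us \<Longrightarrow> x \<in> set xs \<Longrightarrow> F u x \<in> carrier M"
    and R: "\<And>x. x \<in> set xs \<Longrightarrow> map (\<lambda>u. F u x) us \<in> R"
  shows "map (\<lambda>u. oper M s (map (F u) xs)) us \<in> R"
proof -
  \<comment> \<open>\<open>rel_graph\<close> numbers coordinates from 1 and \<open>nth\<close> from
    0, hence the index \<open>i - 1\<close>.\<close>
  define t where "t = (\<lambda>x. \<lambda>i \<in> {1..N}. F (us ! (i - 1)) x)"
  have upt: "map (\<lambda>i \<in> {1..N}. G (us ! (i - 1))) [1..<Suc N] = map G us" for G :: "_ \<Rightarrow> 'b"
    using us by (intro nth_equalityI) (auto simp del: upt_Suc)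
  have "t x \<in> rel_graph N (carrier M) R" if "x \<in> set xs" for x
    using R[OF that] F[OF nth_mem that] us upt[of "\<lambda>u. F u x"]
    by (auto simp: rel_graph_def t_def simp del: upt_Suc)
  then have "map t xs \<in> tuples (length xs) (rel_graph N (carrier M) R)"
    by (auto simp: tuples_def)
  then have "oper (alg_power M {1..N}) s (map t xs) \<in> rel_graph N (carrier M) R"
    using assms(1) s by (auto simp: subalgebra_def algebra_def)
  moreover have "oper (alg_power M {1..N}) s (map t xs) =
      (\<lambda>i \<in> {1..N}. oper M s (map (F (us ! (i - 1))) xs))"
    by (auto simp: alg_power_def t_def comp_def)
  ultimately show ?thesis
    using upt[of "\<lambda>u. oper M s (map (F u) xs)"] by (simp add: rel_graph_def del: upt_Suc)
qed

text \<open>The graph of an n-ary partial operation is an (n+1)-ary relation, which reduces the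
  claim to the relational case.\<close>

lemma part_graph_oper:
  assumes "subalgebra \<sigma> (part_graph n (carrier M) h) (alg_power M {1..Suc n})"
    and s: "\<sigma> s = Some (length xs)" and us: "length us = n"
    and F: "\<And>u x. u \<in> set us \<Longrightarrow> x \<in> set xs \<Longrightarrow> F u x \<in> carrier M"
    and h: "\<And>x. x \<in> set xs \<Longrightarrow> h (map (\<lambda>u. F u x) us) = Some (y x)"
    and y: "\<And>x. x \<in> set xs \<Longrightarrow> y x \<in> carrier M"
  shows "h (map (\<lambda>u. oper M s (map (F u) xs)) us) = Some (oper M s (map y xs))"
proof -
  define R where "R = {ys. h (butlast ys) = Some (last ys)}"
  \<comment> \<open>\<open>None\<close> indexes an extra row holding the values \<open>y x\<close>.
    It comes last, matching the split into \<open>butlast\<close> and \<open>last\<close> in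
    \<open>R\<close>.\<close>
  define F' where "F' = (\<lambda>v x. case v of Some u \<Rightarrow> F u x | None \<Rightarrow> y x)"
  have "part_graph n (carrier M) h = rel_graph (Suc n) (carrier M) R"
    by (simp add: part_graph_def rel_graph_def R_def)
  then have "subalgebra \<sigma> (rel_graph (Suc n) (carrier M) R) (alg_power M {1..Suc n})"
    using assms(1) by simp
  then have "map (\<lambda>v. oper M s (map (F' v) xs)) (map Some us @ [None]) \<in> R"
    by (rule rel_graph_oper) (use s us F h y in \<open>auto simp: F'_def R_def comp_def\<close>)
  then show ?thesis by (simp add: R_def F'_def comp_def)
qed

text \<open>A total operation is treated as a partial one that is defined everywhere.\<close>

lemma tot_graph_oper:
  assumes "subalgebra \<sigma> (tot_graph n (carrier M) g) (alg_power M {1..Suc n})"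
    and "\<sigma> s = Some (length xs)" and "length us = n"
    and "\<And>u x. u \<in> set us \<Longrightarrow> x \<in> set xs \<Longrightarrow> F u x \<in> carrier M"
    and "\<And>x. x \<in> set xs \<Longrightarrow> g (map (\<lambda>u. F u x) us) \<in> carrier M"
  shows "g (map (\<lambda>u. oper M s (map (F u) xs)) us) = oper M s (map (\<lambda>x. g (map (\<lambda>u. F u x) us)) xs)"
proof -
  have "tot_graph n (carrier M) g = part_graph n (carrier M) (\<lambda>xs. Some (g xs))"
    by (simp add: tot_graph_def part_graph_def)
  then show ?thesis
    using part_graph_oper[of \<sigma> n M "\<lambda>xs. Some (g xs)" s xs us F "\<lambda>x. g (map (\<lambda>u. F u x) us)"] assms
    by simp
qed

lemma mor_restrict_substruct:
  assumes \<phi>: "\<phi> \<in> mor \<Sigma> X Y" and S: "closed_under_ops \<Sigma> X S" "S \<subseteq> points X" "\<phi> ` S \<subseteq> T"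
  shows "restrict \<phi> S \<in> mor \<Sigma> (substruct X S) (substruct Y T)"
proof (rule morI)
  have pts: "points (substruct X S) = S" using S(2) by auto
  have tup: "xs \<in> tuples n (points X)" "map (restrict \<phi> S) xs = map \<phi> xs" "xs \<in> tuples n S"
    if "xs \<in> tuples n (points (substruct X S))" for xs n
    using that S(2) by (auto simp: tuples_def)
  show "restrict \<phi> S \<in> points (substruct X S) \<rightarrow>\<^sub>E points (substruct Y T)"
    unfolding pts using S(2,3) morD(6)[OF \<phi>] by auto
  have "continuous_map (subtopology (space X) S) (subtopology (space Y) T) \<phi>"
    using continuous_map_from_subtopology[OF morD(2)[OF \<phi>], of S] S(3)
    by (auto simp: continuous_map_in_subtopology)
  then show "continuous_map (space (substruct X S)) (space (substruct Y T)) (restrict \<phi> S)"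
    by (simp add: continuous_map_eq)
  show "restrict \<phi> S (tot (substruct X S) g xs) = tot (substruct Y T) g (map (restrict \<phi> S) xs)"
    if "tot_ar \<Sigma> g = Some n" "xs \<in> tuples n (points (substruct X S))" for g n xs
    using morD(3)[OF \<phi> that(1) tup(1)[OF that(2)]] tup(2)[OF that(2)]
      closed_under_opsD(1)[OF S(1) that(1) tup(3)[OF that(2)]] by (simp del: map_eq_conv)
  show "part (substruct Y T) h (map (restrict \<phi> S) xs) = Some (restrict \<phi> S y)"
    if "part_ar \<Sigma> h = Some n" "xs \<in> tuples n (points (substruct X S))"
      "part (substruct X S) h xs = Some y" for h n xs y
    using morD(4)[OF \<phi> that(1) tup(1)[OF that(2)]] tup(2)[OF that(2)] that(3)
      closed_under_opsD(2)[OF S(1) that(1) tup(3)[OF that(2)]] by (simp del: map_eq_conv)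
  show "map (restrict \<phi> S) xs \<in> rel (substruct Y T) r"
    if "rel_ar \<Sigma> r = Some n" "xs \<in> tuples n (points (substruct X S))" "xs \<in> rel (substruct X S) r"
    for r n xs
    using morD(5)[OF \<phi> that(1) tup(1)[OF that(2)]] tup(2)[OF that(2)] that(3)
    by (simp del: map_eq_conv)
qed

lemma closed_under_ops_preimage:
  assumes "is_structure \<Sigma> X" and \<phi>: "\<phi> \<in> mor \<Sigma> X Y" and T: "closed_under_ops \<Sigma> Y T"
  shows "closed_under_ops \<Sigma> X {x \<in> points X. \<phi> x \<in> T}"
proof -
  note cl = closed_under_opsD[OF assms(1)[unfolded is_structure_def]]
  have tup: "xs \<in> tuples n (points X)" "map \<phi> xs \<in> tuples n T"
    if "xs \<in> tuples n {x \<in> points X. \<phi> x \<in> T}" for xs n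
    using that by (auto simp: tuples_def)
  show ?thesis
    unfolding closed_under_ops_def
  proof (intro conjI allI impI ballI)
    fix g n xs assume "tot_ar \<Sigma> g = Some n" "xs \<in> tuples n {x \<in> points X. \<phi> x \<in> T}"
    then show "tot X g xs \<in> {x \<in> points X. \<phi> x \<in> T}"
      using cl(1) morD(3)[OF \<phi>] closed_under_opsD(1)[OF T] tup by simp
  next
    fix h n xs y assume "part_ar \<Sigma> h = Some n" "xs \<in> tuples n {x \<in> points X. \<phi> x \<in> T}"
      "part X h xs = Some y"
    then show "y \<in> {x \<in> points X. \<phi> x \<in> T}"
      using cl(2) morD(4)[OF \<phi>] closed_under_opsD(2)[OF T] tup by blast
  qed
qed

text \<open>The exponent is moved along \<open>e\<close> into the index type demanded by \<^const>\<open>in_ISP_dual\<close>.\<close>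

lemma in_ISP_dual_substruct_power:
  fixes e :: "'i \<Rightarrow> ('i \<Rightarrow> 'm) \<Rightarrow> 'm" and Mt :: "('m, 'g, 'h, 'r) tstruct"
  assumes str: "is_structure \<Sigma> Mt" and "I \<noteq> {}" and e: "inj_on e I"
    and T: "closedin (space (struct_power Mt I)) T" "closed_under_ops \<Sigma> (struct_power Mt I) T"
  shows "in_ISP_dual \<Sigma> Mt (substruct (struct_power Mt I) T)"
proof -
  let ?X = "struct_power Mt I" and ?Y = "struct_power Mt (e ` I)"
  \<comment> \<open>\<open>R\<close> and \<open>R'\<close> rename the exponent along
    \<open>e\<close> and back, so they are mutually inverse.\<close>
  define R where "R = (\<lambda>t \<in> I \<rightarrow>\<^sub>E points Mt. \<lambda>j \<in> e ` I. t (inv_into I e j))"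
  define R' where "R' = (\<lambda>t \<in> e ` I \<rightarrow>\<^sub>E points Mt. \<lambda>i \<in> I. t (e i))"
  \<comment> \<open>This is the image of \<open>T\<close> under \<open>R\<close>. Written as a
    preimage under the morphism \<open>R'\<close>, it is at once closed and closed under the
    operations.\<close>
  define S where "S = {t \<in> points ?Y. R' t \<in> T}"
  have R: "R \<in> mor \<Sigma> ?X ?Y"
    unfolding R_def by (rule mor_reindex_power[OF str]) (auto intro: inv_into_into)
  have R': "R' \<in> mor \<Sigma> ?Y ?X"
    unfolding R'_def by (rule mor_reindex_power[OF str]) auto
  have TX: "T \<subseteq> points ?X" using closedin_subset[OF T(1)] .
  have R'R: "R' (R t) = t" if "t \<in> points ?X" for t
  proof -
    have "R t \<in> e ` I \<rightarrow>\<^sub>E points Mt" using morD(6)[OF R that] by simp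
    then have "R' (R t) = (\<lambda>i \<in> I. R t (e i))" by (simp add: R'_def)
    also have "\<dots> = (\<lambda>i \<in> I. t i)" 
      using that e by (intro restrict_ext) (simp add: R_def)
    finally have "R' (R t) = (\<lambda>i \<in> I. t i)" .
    then show ?thesis using that by (simp add: PiE_restrict)
  qed
  have RR': "R (R' t) = t" if "t \<in> points ?Y" for t
  proof -
    have "R' t \<in> I \<rightarrow>\<^sub>E points Mt" using morD(6)[OF R' that] by simp
    then have "R (R' t) = (\<lambda>j \<in> e ` I. R' t (inv_into I e j))" by (simp add: R_def)
    also have "\<dots> = (\<lambda>j \<in> e ` I. t j)"
      using that by (intro restrict_ext) (auto simp: R'_def e)
    finally have "R (R' t) = (\<lambda>j \<in> e ` I. t j)" .
    then show ?thesis using that by (simp add: PiE_restrict)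
  qed
  have strY: "is_structure \<Sigma> ?Y" by (rule is_structure_struct_power[OF str])
  have clS: "closed_under_ops \<Sigma> ?Y S"
    unfolding S_def by (rule closed_under_ops_preimage[OF strY R' T(2)])
  have "closedin (space ?Y) S"
    unfolding S_def by (rule closedin_continuous_map_preimage[OF morD(2)[OF R'] T(1)])
  moreover have "struct_iso \<Sigma> (substruct ?X T) (substruct ?Y S) (restrict R T)"
    unfolding struct_iso_def
  proof (intro conjI bexI[of _ "restrict R' S"])
    have "R ` T \<subseteq> S" using TX morD(6)[OF R] by (auto simp: S_def R'R simp del: points_struct_power)
    then show "restrict R T \<in> mor \<Sigma> (substruct ?X T) (substruct ?Y S)"
      by (rule mor_restrict_substruct[OF R T(2) TX])
    then show "\<forall>x \<in> points (substruct ?X T). restrict R' S (restrict R T x) = x"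
      using \<open>R ` T \<subseteq> S\<close> R'R by auto
    show "restrict R' S \<in> mor \<Sigma> (substruct ?Y S) (substruct ?X T)"
      by (rule mor_restrict_substruct[OF R' clS]) (auto simp: S_def)
    show "\<forall>y \<in> points (substruct ?Y S). restrict R T (restrict R' S y) = y"
      using RR' by (auto simp: S_def)
  qed
  ultimately have "closed_embedding \<Sigma> (substruct ?X T) ?Y (restrict R T)"
    using clS by (auto simp: closed_embedding_def)
  moreover have "is_structure \<Sigma> (substruct ?X T)"
    by (rule is_structure_substruct[OF T(2) TX])
  ultimately show ?thesis
    using \<open>I \<noteq> {}\<close> unfolding in_ISP_dual_def
    by (intro conjI exI[of _ "e ` I"] exI[of _ "restrict R T"]) auto
qed

section \<open>Hom-sets as objects of the dual category\<close>

locale alter_ego_setting =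
  fixes \<sigma> :: "'f signature" and M :: "('m, 'f) alg"
    and \<Sigma> :: "('g, 'h, 'r) tsignature" and Mt :: "('m, 'g, 'h, 'r) tstruct"
  assumes algebra_M: "algebra \<sigma> M" and alter_ego: "alter_ego \<sigma> M \<Sigma> Mt"
begin

lemma space_Mt: "space Mt = discrete_topology (carrier M)"
  and is_structure_Mt: "is_structure \<Sigma> Mt"
  using alter_ego by (auto simp: alter_ego_def)

lemma points_Mt [simp]: "points Mt = carrier M"
  by (simp add: space_Mt)

text \<open>\<open>tot_oper\<close> and \<open>part_oper\<close> are read in two ways. With
  homomorphisms as \<open>us\<close> and elements of an algebra as \<open>xs\<close>, they make
  hom-sets closed under the structure; with points as \<open>us\<close> and morphisms as
  \<open>xs\<close>, they make morphisms into the alter ego closed under the operations of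
  \<open>M\<close>.\<close>

lemma tot_oper:
  assumes g: "tot_ar \<Sigma> g = Some n" and s: "\<sigma> s = Some k" and "length xs = k" "length us = n"
    and F: "\<And>u x. u \<in> set us \<Longrightarrow> x \<in> set xs \<Longrightarrow> F u x \<in> carrier M"
  shows "tot Mt g (map (\<lambda>u. oper M s (map (F u) xs)) us) =
    oper M s (map (\<lambda>x. tot Mt g (map (\<lambda>u. F u x) us)) xs)"
proof (rule tot_graph_oper)
  show "subalgebra \<sigma> (tot_graph n (carrier M) (tot Mt g)) (alg_power M {1..Suc n})"
    using alter_ego g by (auto simp: alter_ego_def)
  show "tot Mt g (map (\<lambda>u. F u x) us) \<in> carrier M" if "x \<in> set xs" for x
  proof -
    have "map (\<lambda>u. F u x) us \<in> tuples n (points Mt)"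
      using F[OF _ that] \<open>length us = n\<close> by (auto simp: tuples_def)
    from closed_under_opsD(1)[OF is_structure_Mt[unfolded is_structure_def] g this]
    show ?thesis by simp
  qed
qed (use assms in auto)

lemma part_oper:
  assumes h: "part_ar \<Sigma> h = Some n" and s: "\<sigma> s = Some k" and "length xs = k" "length us = n"
    and F: "\<And>u x. u \<in> set us \<Longrightarrow> x \<in> set xs \<Longrightarrow> F u x \<in> carrier M"
    and y: "\<And>x. x \<in> set xs \<Longrightarrow> part Mt h (map (\<lambda>u. F u x) us) = Some (y x)"
  shows "part Mt h (map (\<lambda>u. oper M s (map (F u) xs)) us) = Some (oper M s (map y xs))"
proof (rule part_graph_oper)
  show "subalgebra \<sigma> (part_graph n (carrier M) (part Mt h)) (alg_power M {1..Suc n})"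
    using alter_ego h by (auto simp: alter_ego_def)
  show "y x \<in> carrier M" if "x \<in> set xs" for x
  proof -
    have "map (\<lambda>u. F u x) us \<in> tuples n (points Mt)"
      using F[OF _ that] \<open>length us = n\<close> by (auto simp: tuples_def)
    from closed_under_opsD(2)[OF is_structure_Mt[unfolded is_structure_def] h this y[OF that]]
    show ?thesis by simp
  qed
qed (use assms in auto)

lemma rel_oper:
  assumes "rel_ar \<Sigma> r = Some n" and "\<sigma> s = Some k" and "length xs = k" "length us = n"
    and "\<And>u x. u \<in> set us \<Longrightarrow> x \<in> set xs \<Longrightarrow> F u x \<in> carrier M"
    and "\<And>x. x \<in> set xs \<Longrightarrow> map (\<lambda>u. F u x) us \<in> rel Mt r"
  shows "map (\<lambda>u. oper M s (map (F u) xs)) us \<in> rel Mt r"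
proof (rule rel_graph_oper)
  show "subalgebra \<sigma> (rel_graph n (carrier M) (rel Mt r)) (alg_power M {1..n})"
    using alter_ego assms(1) by (auto simp: alter_ego_def)
qed (use assms in auto)

lemma hom_subset_power: "hom \<sigma> A M \<subseteq> points (struct_power Mt (carrier A))"
  by (auto dest: hom_PiE)

lemma points_dual_space [simp]: "points (dual_space \<sigma> M Mt A) = hom \<sigma> A M"
  using hom_subset_power[of A] by (simp add: dual_space_def inf.absorb2)

text \<open>A pointwise combination of homomorphisms by \<open>g\<close> or \<open>h\<close>
  preserves \<open>s\<close> because \<open>g\<close> and \<open>h\<close> commute with
  \<open>s\<close> on \<open>M\<close>.\<close>

lemma closed_under_ops_hom:
  assumes alg: "algebra \<sigma> A"
  shows "closed_under_ops \<Sigma> (struct_power Mt (carrier A)) (hom \<sigma> A M)"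
  unfolding closed_under_ops_def
proof (intro conjI allI impI ballI)
  fix g n us assume g: "tot_ar \<Sigma> g = Some n" and us: "us \<in> tuples n (hom \<sigma> A M)"
  let ?t = "tot (struct_power Mt (carrier A)) g us"
  have val: "?t a = tot Mt g (map (\<lambda>u. u a) us)" if "a \<in> carrier A" for a
    using that by (simp add: struct_power_def)
  show "?t \<in> hom \<sigma> A M"
  proof (rule homI)
    show "?t \<in> carrier A \<rightarrow>\<^sub>E carrier M"
      using closed_under_opsD(1)[OF is_structure_struct_power[OF is_structure_Mt,
            unfolded is_structure_def] g, of us "carrier A"]
        us hom_subset_power[of A] by (auto simp: tuples_def)
  next
    fix s k xs assume s: "\<sigma> s = Some k" and xs: "xs \<in> tuples k (carrier A)"
    have "?t (oper A s xs) = tot Mt g (map (\<lambda>u. u (oper A s xs)) us)"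
      by (rule val[OF algebra_oper[OF alg s xs]])
    also have "map (\<lambda>u. u (oper A s xs)) us = map (\<lambda>u. oper M s (map u xs)) us"
      using us hom_oper[where \<sigma> = \<sigma> and xs = xs and A = A, OF _ s xs] by (auto simp: tuples_def)
    also have "tot Mt g \<dots> = oper M s (map (\<lambda>x. tot Mt g (map (\<lambda>u. u x) us)) xs)"
      using us xs by (intro tot_oper[OF g s]) (auto simp: tuples_def intro: hom_closed)
    also have "map (\<lambda>x. tot Mt g (map (\<lambda>u. u x) us)) xs = map ?t xs"
      using xs val by (auto simp: tuples_def)
    finally show "?t (oper A s xs) = oper M s (map ?t xs)" .
  qed
next
  fix h n us y assume h: "part_ar \<Sigma> h = Some n" and us: "us \<in> tuples n (hom \<sigma> A M)"
    and y: "part (struct_power Mt (carrier A)) h us = Some y"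
  have val: "part Mt h (map (\<lambda>u. u a) us) = Some (y a)" if "a \<in> carrier A" for a
    using that y by (auto simp: struct_power_def split: if_splits)
  show "y \<in> hom \<sigma> A M"
  proof (rule homI)
    show "y \<in> carrier A \<rightarrow>\<^sub>E carrier M"
      using closed_under_opsD(2)[OF is_structure_struct_power[OF is_structure_Mt,
            unfolded is_structure_def] h _ y]
        us hom_subset_power[of A] by (auto simp: tuples_def)
  next
    fix s k xs assume s: "\<sigma> s = Some k" and xs: "xs \<in> tuples k (carrier A)"
    have "Some (y (oper A s xs)) = part Mt h (map (\<lambda>u. u (oper A s xs)) us)"
      by (rule val[OF algebra_oper[OF alg s xs], symmetric])
    also have "map (\<lambda>u. u (oper A s xs)) us = map (\<lambda>u. oper M s (map u xs)) us"
      using us hom_oper[where \<sigma> = \<sigma> and xs = xs and A = A, OF _ s xs] by (auto simp: tuples_def)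
    also have "part Mt h \<dots> = Some (oper M s (map y xs))"
      using us xs val by (intro part_oper[OF h s]) (auto simp: tuples_def intro: hom_closed)
    finally show "y (oper A s xs) = oper M s (map y xs)" by simp
  qed
qed

text \<open>Violating the law for one symbol and one argument tuple depends on finitely many
  coordinates of \<open>t\<close>, so it is an open condition. The complement of the hom-set in the
  power is the union of these open sets.\<close>

lemma closedin_hom:
  assumes alg: "algebra \<sigma> A"
  shows "closedin (space (struct_power Mt (carrier A))) (hom \<sigma> A M)"
proof -
  let ?T = "product_topology (\<lambda>_. discrete_topology (carrier M)) (carrier A)"
  have "openin ?T {t \<in> topspace ?T. t (oper A s xs) \<noteq> oper M s (map t xs)}"
    if s: "\<sigma> s = Some n" and xs: "xs \<in> tuples n (carrier A)" for s n xs
  proof -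
    have "\<forall>w \<in> set ((\<lambda>t. t (oper A s xs)) # map (\<lambda>x t. t x) xs).
        continuous_map ?T (discrete_topology (carrier M)) w"
      using algebra_oper[OF alg s xs] xs
      by (auto simp: tuples_def intro!: continuous_map_product_projection)
    \<comment> \<open>The head is the coordinate at \<open>oper A s xs\<close>, and the tail lists
      the coordinates at the entries of \<open>xs\<close>.\<close>
    from openin_finitely_many_discrete_maps[OF this, of "\<lambda>ys. hd ys \<noteq> oper M s (tl ys)"]
    show ?thesis by (simp add: comp_def)
  qed
  then have "openin ?T (\<Union>(s, xs) \<in> {(s, xs). \<exists>n. \<sigma> s = Some n \<and> xs \<in> tuples n (carrier A)}.
      {t \<in> topspace ?T. t (oper A s xs) \<noteq> oper M s (map t xs)})"
    by (intro openin_Union) auto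
  moreover have "topspace ?T - hom \<sigma> A M =
      (\<Union>(s, xs) \<in> {(s, xs). \<exists>n. \<sigma> s = Some n \<and> xs \<in> tuples n (carrier A)}.
      {t \<in> topspace ?T. t (oper A s xs) \<noteq> oper M s (map t xs)})"
    by (auto simp: hom_def)
  moreover have "hom \<sigma> A M \<subseteq> topspace ?T" by (auto dest: hom_PiE)
  ultimately show ?thesis
    by (simp add: closedin_def struct_power_def space_Mt)
qed

lemma is_structure_dual_space: "algebra \<sigma> A \<Longrightarrow> is_structure \<Sigma> (dual_space \<sigma> M Mt A)"
  unfolding dual_space_def
  by (rule is_structure_substruct[OF closed_under_ops_hom hom_subset_power])

text \<open>The power at hand has exponent \<open>carrier A\<close>, whereas
  \<open>in_ISP_dual\<close> wants a set of functions from the points of the structure to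
  \<open>'m\<close>. Evaluation turns \<open>a\<close> into such a function, injectively because
  homomorphisms into \<open>M\<close> separate the points of \<open>A\<close>.\<close>

lemma in_ISP_dual_dual_space:
  assumes "in_ISP \<sigma> M A"
  shows "in_ISP_dual \<Sigma> Mt (dual_space \<sigma> M Mt A)"
  unfolding dual_space_def
proof (rule in_ISP_dual_substruct_power[OF is_structure_Mt])
  have alg: "algebra \<sigma> A" using assms by (rule in_ISP_algebra)
  then show "carrier A \<noteq> {}" by (simp add: algebra_def)
  show "inj_on (\<lambda>a. \<lambda>u \<in> hom \<sigma> A M. u a) (carrier A)"
  proof (rule inj_onI)
    fix a b assume ab: "a \<in> carrier A" "b \<in> carrier A"
      and eq: "(\<lambda>u \<in> hom \<sigma> A M. u a) = (\<lambda>u \<in> hom \<sigma> A M. u b)"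
    show "a = b"
      using fun_cong[OF eq] by (intro in_ISP_separates[OF assms ab]) (metis restrict_apply')
  qed
  show "closedin (space (struct_power Mt (carrier A))) (hom \<sigma> A M)"
    by (rule closedin_hom[OF alg])
  show "closed_under_ops \<Sigma> (struct_power Mt (carrier A)) (hom \<sigma> A M)"
    by (rule closed_under_ops_hom[OF alg])
qed

text \<open>This is reindexing of powers along \<open>\<phi>\<close>, cut down to hom-sets; it lands
  in the right hom-set because homomorphisms compose.\<close>

lemma mor_dual:
  assumes A: "\<forall>s n. \<sigma> s = Some n \<longrightarrow> (\<forall>xs \<in> tuples n (carrier A). oper A s xs \<in> carrier A)"
    and B: "algebra \<sigma> B" and \<phi>: "\<phi> \<in> hom \<sigma> A B"
  shows "(\<lambda>u \<in> hom \<sigma> B M. \<lambda>a \<in> carrier A. u (\<phi> a)) \<in>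
    mor \<Sigma> (dual_space \<sigma> M Mt B) (dual_space \<sigma> M Mt A)"
proof -
  let ?R = "\<lambda>t \<in> carrier B \<rightarrow>\<^sub>E points Mt. \<lambda>a \<in> carrier A. t (\<phi> a)"
  have "?R \<in> mor \<Sigma> (struct_power Mt (carrier B)) (struct_power Mt (carrier A))"
    using \<phi> by (intro mor_reindex_power is_structure_Mt) (auto intro: hom_closed)
  then have "restrict ?R (hom \<sigma> B M) \<in> mor \<Sigma> (dual_space \<sigma> M Mt B) (dual_space \<sigma> M Mt A)"
    unfolding dual_space_def
  proof (rule mor_restrict_substruct[OF _ closed_under_ops_hom[OF B] hom_subset_power])
    show "?R ` hom \<sigma> B M \<subseteq> hom \<sigma> A M"
      using hom_compose[OF A \<phi>] hom_subset_power[of B] by auto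
  qed
  moreover have "restrict ?R (hom \<sigma> B M) = (\<lambda>u \<in> hom \<sigma> B M. \<lambda>a \<in> carrier A. u (\<phi> a))"
    using hom_subset_power[of B] by (intro ext) (auto simp: restrict_def)
  ultimately show ?thesis by simp
qed

text \<open>The commutation laws are used with points as rows and morphisms as columns. Continuity
  holds because an operation combines finitely many morphisms into a discrete space.\<close>

lemma mor_oper:
  assumes "is_structure \<Sigma> X" and s: "\<sigma> s = Some k" and ws: "ws \<in> tuples k (mor \<Sigma> X Mt)"
  shows "(\<lambda>x \<in> points X. oper M s (map (\<lambda>w. w x) ws)) \<in> mor \<Sigma> X Mt" (is "?p \<in> _")
proof (rule morI)
  note cl = closed_under_opsD[OF assms(1)[unfolded is_structure_def]]
  have w: "w \<in> mor \<Sigma> X Mt" if "w \<in> set ws" for w using ws that by (auto simp: tuples_def)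
  have wM: "w x \<in> carrier M" if "w \<in> set ws" "x \<in> points X" for w x
    using morD(6)[OF w[OF that(1)] that(2)] by simp
  have val: "oper M s (map (\<lambda>w. w x) ws) \<in> carrier M" if "x \<in> points X" for x
    by (rule algebra_oper[OF algebra_M s]) (use ws wM that in \<open>auto simp: tuples_def\<close>)
  have mp: "map ?p xs = map (\<lambda>x. oper M s (map (\<lambda>w. w x) ws)) xs"
    if "xs \<in> tuples n (points X)" for xs n
    using that by (auto simp: tuples_def)
  have len: "length ws = k" using ws by (simp add: tuples_def)
  show "?p \<in> points X \<rightarrow>\<^sub>E points Mt" using val by auto
  have "continuous_map (space X) (discrete_topology (carrier M)) (\<lambda>x. oper M s (map (\<lambda>w. w x) ws))"
    using morD(2)[OF w] val
    by (intro continuous_map_finitely_many_discrete_maps) (auto simp: space_Mt)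
  then show "continuous_map (space X) (space Mt) ?p"
    unfolding space_Mt by (rule continuous_map_eq) simp
  show "?p (tot X g xs) = tot Mt g (map ?p xs)"
    if g: "tot_ar \<Sigma> g = Some n" and xs: "xs \<in> tuples n (points X)" for g n xs
  proof -
    have "?p (tot X g xs) = oper M s (map (\<lambda>w. w (tot X g xs)) ws)"
      using cl(1)[OF g xs] by simp
    also have "map (\<lambda>w. w (tot X g xs)) ws = map (\<lambda>w. tot Mt g (map w xs)) ws"
      using morD(3)[OF w g xs] by simp
    also have "oper M s \<dots> = tot Mt g (map (\<lambda>x. oper M s (map (\<lambda>w. w x) ws)) xs)"
      using len wM xs by (intro tot_oper[OF g s, symmetric]) (auto simp: tuples_def)
    finally show ?thesis unfolding mp[OF xs] .
  qed
  show "part Mt h (map ?p xs) = Some (?p y)"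
    if h: "part_ar \<Sigma> h = Some n" and xs: "xs \<in> tuples n (points X)" and y: "part X h xs = Some y"
    for h n xs y
  proof -
    have "part Mt h (map (\<lambda>x. oper M s (map (\<lambda>w. w x) ws)) xs) =
        Some (oper M s (map (\<lambda>w. w y) ws))"
      using len wM xs morD(4)[OF w h xs y] by (intro part_oper[OF h s]) (auto simp: tuples_def)
    then show ?thesis using cl(2)[OF h xs y] unfolding mp[OF xs] by simp
  qed
  show "map ?p xs \<in> rel Mt r"
    if r: "rel_ar \<Sigma> r = Some n" and xs: "xs \<in> tuples n (points X)" and "xs \<in> rel X r" for r n xs
    unfolding mp[OF xs]
    using len wM xs morD(5)[OF w r xs \<open>xs \<in> rel X r\<close>]
    by (intro rel_oper[OF r s]) (auto simp: tuples_def)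
qed

end

text \<open>An infinite type contains a copy of its square, so tuples can be coded by single
  elements, one coordinate at a time. This makes room in \<open>'u\<close> for a copy of
  A^n.\<close>

lemma ex_inj_on_PiE_atLeastAtMost:
  assumes "infinite (UNIV :: 'u set)"
  shows "\<exists>j :: (nat \<Rightarrow> 'u) \<Rightarrow> 'u. inj_on j ({1..n} \<rightarrow>\<^sub>E C)"
proof (induction n)
  case 0
  then show ?case by (auto simp: inj_on_def)
next
  case (Suc n)
  then obtain j :: "(nat \<Rightarrow> 'u) \<Rightarrow> 'u" where j: "inj_on j ({1..n} \<rightarrow>\<^sub>E C)" by blast
  have "(card_of (UNIV \<times> UNIV :: ('u \<times> 'u) set), card_of (UNIV :: 'u set)) \<in> ordLeq"
    using card_of_Times_same_infinite[OF assms] by (simp add: ordIso_iff_ordLeq)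
  then obtain p :: "'u \<times> 'u \<Rightarrow> 'u" where p: "inj p"
    using card_of_ordLeq[of "UNIV :: ('u \<times> 'u) set" "UNIV :: 'u set"] by auto
  have "inj_on (\<lambda>t. p (j (restrict t {1..n}), t (Suc n))) ({1..Suc n} \<rightarrow>\<^sub>E C)"
  proof (rule inj_onI)
    fix t t' assume t: "t \<in> {1..Suc n} \<rightarrow>\<^sub>E C" and t': "t' \<in> {1..Suc n} \<rightarrow>\<^sub>E C"
      and eq: "p (j (restrict t {1..n}), t (Suc n)) = p (j (restrict t' {1..n}), t' (Suc n))"
    have "restrict t {1..n} \<in> {1..n} \<rightarrow>\<^sub>E C" "restrict t' {1..n} \<in> {1..n} \<rightarrow>\<^sub>E C"
      using t t' by auto
    moreover have "j (restrict t {1..n}) = j (restrict t' {1..n})" and S: "t (Suc n) = t' (Suc n)"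
      using injD[OF p eq] by auto
    ultimately have "restrict t {1..n} = restrict t' {1..n}" using inj_onD[OF j] by blast
    then have "t i = t' i" if "i \<in> {1..n}" for i using that by (metis restrict_apply')
    then show "t = t'" using S by (intro PiE_ext[OF t t']) (auto simp: le_Suc_eq)
  qed
  then show ?case by blast
qed

section \<open>Duals of finite powers\<close>

context alter_ego_setting
begin

lemma dual_alg_oper_closed:
  assumes "is_structure \<Sigma> X" "\<sigma> s = Some k" "ws \<in> tuples k (mor \<Sigma> X Mt)"
  shows "oper (dual_alg M \<Sigma> Mt X) s ws \<in> mor \<Sigma> X Mt"
  using mor_oper[OF assms] by (simp add: dual_alg_def alg_power_def)

text \<open>Dualities turn products into coproducts; this carries it out for a product
  \<open>P\<close> of copies of \<open>A\<close> along the \<open>pr i\<close>. Given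
  \<open>\<psi> i\<close> into \<open>Z\<close>, a morphism \<open>w\<close> from \<open>Z\<close>
  to the alter ego yields morphisms w o \<psi> i, that is, elements of \<open>A\<close>, hence an
  element of \<open>P\<close>. Dualizing this homomorphism \<open>\<beta>\<close> into
  \<open>P\<close> and undoing the evaluation of \<open>Z\<close> gives the mediating
  morphism.\<close>

lemma is_coproduct_dual_product:
  fixes A P :: "('u, 'f) alg" and pr :: "nat \<Rightarrow> 'u \<Rightarrow> 'u"
  assumes dual: "dual_equivalence TYPE('u) \<sigma> M \<Sigma> Mt"
    and A: "in_ISP \<sigma> M A" and P: "in_ISP \<sigma> M P"
    and pr: "\<And>i. i \<in> {1..n} \<Longrightarrow> pr i \<in> hom \<sigma> P A"
    and surj: "\<And>t. t \<in> {1..n} \<rightarrow> carrier A \<Longrightarrow> \<exists>p \<in> carrier P. \<forall>i \<in> {1..n}. pr i p = t i"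
    and inj: "\<And>p q. p \<in> carrier P \<Longrightarrow> q \<in> carrier P \<Longrightarrow>
      (\<And>i. i \<in> {1..n} \<Longrightarrow> pr i p = pr i q) \<Longrightarrow> p = q"
  shows "is_coproduct \<Sigma> Mt n (\<lambda>_. dual_space \<sigma> M Mt A) (dual_space \<sigma> M Mt P)
    (\<lambda>i. \<lambda>u \<in> hom \<sigma> A M. \<lambda>p \<in> carrier P. u (pr i p))"
    (is "is_coproduct _ _ _ _ _ ?\<iota>")
  unfolding is_coproduct_def
proof (intro conjI ballI allI impI)
  let ?A = "dual_space \<sigma> M Mt A" and ?P = "dual_space \<sigma> M Mt P"
  have algA: "algebra \<sigma> A" and algP: "algebra \<sigma> P" using A P by (auto intro: in_ISP_algebra)
  show "in_ISP_dual \<Sigma> Mt ?P" by (rule in_ISP_dual_dual_space[OF P])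
  show \<iota>: "?\<iota> i \<in> mor \<Sigma> ?A ?P" if "i \<in> {1..n}" for i
    by (rule mor_dual[OF algebra_opers[OF algP] algA pr[OF that]])
  have strA: "is_structure \<Sigma> ?A" and strP: "is_structure \<Sigma> ?P"
    using algA algP by (auto intro: is_structure_dual_space)
  have evA: "alg_iso \<sigma> A (dual_alg M \<Sigma> Mt ?A) (eval_alg \<sigma> M A)"
    and evP: "alg_iso \<sigma> P (dual_alg M \<Sigma> Mt ?P) (eval_alg \<sigma> M P)"
    using dual A P by (auto simp: dual_equivalence_def)
  \<comment> \<open>Surjectivity of the evaluation map: a morphism from the dual of \<open>A\<close>
    into the alter ego is evaluation at an element of \<open>A\<close>.\<close>
  have surjA: "\<exists>a \<in> carrier A. \<forall>u \<in> hom \<sigma> A M. w u = u a" if "w \<in> mor \<Sigma> ?A Mt" for w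
  proof -
    have "w \<in> eval_alg \<sigma> M A ` carrier A"
      using evA that by (simp add: alg_iso_def bij_betw_def dual_alg_def)
    then show ?thesis by (auto simp: eval_alg_def)
  qed
  have surjP: "\<exists>a \<in> carrier P. \<forall>u \<in> hom \<sigma> P M. w u = u a" if "w \<in> mor \<Sigma> ?P Mt" for w
  proof -
    have "w \<in> eval_alg \<sigma> M P ` carrier P"
      using evP that by (simp add: alg_iso_def bij_betw_def dual_alg_def)
    then show ?thesis by (auto simp: eval_alg_def)
  qed
  fix Z :: "('u \<Rightarrow> 'm, 'g, 'h, 'r) tstruct" and \<psi>
  assume "in_ISP_dual \<Sigma> Mt Z \<and> (\<forall>i \<in> {1..n}. \<psi> i \<in> mor \<Sigma> ?A Z)"
  then have Z: "in_ISP_dual \<Sigma> Mt Z" and \<psi>: "\<And>i. i \<in> {1..n} \<Longrightarrow> \<psi> i \<in> mor \<Sigma> ?A Z" by auto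
  have strZ: "is_structure \<Sigma> Z" using Z by (simp add: in_ISP_dual_def)
  let ?D = "dual_alg M \<Sigma> Mt Z"
  have "struct_iso \<Sigma> Z (dual_space \<sigma> M Mt ?D) (eval_space \<Sigma> Mt Z)"
    using dual Z by (simp add: dual_equivalence_def)
  then obtain \<chi> where evZ: "eval_space \<Sigma> Mt Z \<in> mor \<Sigma> Z (dual_space \<sigma> M Mt ?D)"
    and \<chi>: "\<chi> \<in> mor \<Sigma> (dual_space \<sigma> M Mt ?D) Z"
    and \<chi>ev: "\<And>z. z \<in> points Z \<Longrightarrow> \<chi> (eval_space \<Sigma> Mt Z z) = z"
    by (auto simp: struct_iso_def)
  \<comment> \<open>\<open>\<chi>\<close> undoes evaluation, and evaluation at a point records the
    values there of all morphisms into the alter ego.\<close>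
  have sepZ: "z = z'"
    if "z \<in> points Z" "z' \<in> points Z" "\<And>w. w \<in> mor \<Sigma> Z Mt \<Longrightarrow> w z = w z'" for z z'
  proof -
    have "eval_space \<Sigma> Mt Z z = eval_space \<Sigma> Mt Z z'"
      using that by (auto simp: eval_space_def)
    then show ?thesis using \<chi>ev that(1,2) by metis
  qed
  have carD: "carrier ?D = mor \<Sigma> Z Mt" by (simp add: dual_alg_def)
  \<comment> \<open>Each w o \<psi> i is evaluation at some \<open>t i\<close>, and
    \<open>surj\<close> collects the \<open>t i\<close> into one element of
    \<open>P\<close>.\<close>
  have "\<exists>p \<in> carrier P. \<forall>i \<in> {1..n}. \<forall>u \<in> hom \<sigma> A M. u (pr i p) = w (\<psi> i u)"
    if w: "w \<in> mor \<Sigma> Z Mt" for w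
  proof -
    have "\<exists>a \<in> carrier A. \<forall>u \<in> hom \<sigma> A M. w (\<psi> i u) = u a" if "i \<in> {1..n}" for i
      using surjA[OF mor_compose[OF strA \<psi>[OF that] w]] by simp
    then have "\<forall>i \<in> {1..n}. \<exists>a. a \<in> carrier A \<and> (\<forall>u \<in> hom \<sigma> A M. w (\<psi> i u) = u a)" by blast
    then obtain t where t: "\<forall>i \<in> {1..n}. t i \<in> carrier A \<and> (\<forall>u \<in> hom \<sigma> A M. w (\<psi> i u) = u (t i))"
      by (rule bchoice[THEN exE])
    then have "t \<in> {1..n} \<rightarrow> carrier A" by auto
    then obtain p where "p \<in> carrier P" "\<forall>i \<in> {1..n}. pr i p = t i" using surj by blast
    then show ?thesis using t by (intro bexI[of _ p]) auto
  qed
  then have "\<forall>w \<in> mor \<Sigma> Z Mt. \<exists>p. p \<in> carrier P \<and>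
      (\<forall>i \<in> {1..n}. \<forall>u \<in> hom \<sigma> A M. u (pr i p) = w (\<psi> i u))"
    by blast
  then obtain \<beta>0 where "\<forall>w \<in> mor \<Sigma> Z Mt. \<beta>0 w \<in> carrier P \<and>
      (\<forall>i \<in> {1..n}. \<forall>u \<in> hom \<sigma> A M. u (pr i (\<beta>0 w)) = w (\<psi> i u))"
    by (rule bchoice[THEN exE])
  then have \<beta>0: "\<And>w. w \<in> mor \<Sigma> Z Mt \<Longrightarrow> \<beta>0 w \<in> carrier P"
    "\<And>w i u. w \<in> mor \<Sigma> Z Mt \<Longrightarrow> i \<in> {1..n} \<Longrightarrow> u \<in> hom \<sigma> A M \<Longrightarrow> u (pr i (\<beta>0 w)) = w (\<psi> i u)"
    by auto
  \<comment> \<open>Members of \<open>hom\<close> are extensional, so the choice function is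
    restricted.\<close>
  define \<beta> where "\<beta> = restrict \<beta>0 (mor \<Sigma> Z Mt)"
  have eqP: "p = q" if "p \<in> carrier P" "q \<in> carrier P"
    "\<And>i u. i \<in> {1..n} \<Longrightarrow> u \<in> hom \<sigma> A M \<Longrightarrow> u (pr i p) = u (pr i q)" for p q
  proof (rule inj[OF that(1,2)])
    fix i assume i: "i \<in> {1..n}"
    show "pr i p = pr i q"
      by (rule in_ISP_separates[OF A]) (use i that hom_closed[OF pr[OF i]] in auto)
  qed
  have \<beta>: "\<beta> \<in> hom \<sigma> ?D P"
  proof (rule homI)
    show "\<beta> \<in> carrier ?D \<rightarrow>\<^sub>E carrier P" unfolding carD \<beta>_def using \<beta>0(1) by auto
  next
    fix s k ws assume s: "\<sigma> s = Some k" and "ws \<in> tuples k (carrier ?D)"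
    then have ws: "ws \<in> tuples k (mor \<Sigma> Z Mt)" by (simp add: carD)
    let ?w = "oper ?D s ws"
    have w: "?w \<in> mor \<Sigma> Z Mt" by (rule dual_alg_oper_closed[OF strZ s ws])
    have bs: "map \<beta> ws \<in> tuples k (carrier P)"
      using ws \<beta>0(1) by (auto simp: tuples_def \<beta>_def)
    show "\<beta> ?w = oper P s (map \<beta> ws)"
    proof (rule eqP)
      show "\<beta> ?w \<in> carrier P" using \<beta>0(1) w by (simp add: \<beta>_def)
      show "oper P s (map \<beta> ws) \<in> carrier P" by (rule algebra_oper[OF algP s bs])
      fix i u assume i: "i \<in> {1..n}" and u: "u \<in> hom \<sigma> A M"
      have z: "\<psi> i u \<in> points Z" using morD(6)[OF \<psi>[OF i]] u by simp
      have "u (pr i (\<beta> ?w)) = ?w (\<psi> i u)" using \<beta>0(2)[OF w i u] w by (simp add: \<beta>_def)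
      also have "\<dots> = oper M s (map (\<lambda>w. w (\<psi> i u)) ws)"
        using z by (simp add: dual_alg_def alg_power_def)
      also have "map (\<lambda>w. w (\<psi> i u)) ws = map (\<lambda>w. u (pr i (\<beta> w))) ws"
        using ws \<beta>0(2)[OF _ i u] by (auto simp: tuples_def \<beta>_def)
      also have "\<dots> = map u (map (pr i) (map \<beta> ws))" by simp
      also have "oper M s \<dots> = u (pr i (oper P s (map \<beta> ws)))"
      proof -
        have "map (pr i) (map \<beta> ws) \<in> tuples k (carrier A)"
          using bs hom_closed[OF pr[OF i]] by (auto simp: tuples_def)
        then show ?thesis by (simp only: hom_oper[OF u s] hom_oper[OF pr[OF i] s bs])
      qed
      finally show "u (pr i (\<beta> ?w)) = u (pr i (oper P s (map \<beta> ws)))" .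
    qed
  qed
  show "\<exists>!\<theta>. \<theta> \<in> mor \<Sigma> ?P Z \<and> (\<forall>i \<in> {1..n}. \<forall>x \<in> points ?A. \<theta> (?\<iota> i x) = \<psi> i x)"
  proof (rule ex_ex1I)
    show "\<exists>\<theta>. \<theta> \<in> mor \<Sigma> ?P Z \<and> (\<forall>i \<in> {1..n}. \<forall>x \<in> points ?A. \<theta> (?\<iota> i x) = \<psi> i x)"
    proof (intro exI conjI ballI)
      \<comment> \<open>The mediating morphism is the dual of \<open>\<beta>\<close> followed by the
        inverse \<open>\<chi>\<close> of the evaluation of \<open>Z\<close>.\<close>
      let ?\<beta> = "\<lambda>u \<in> hom \<sigma> P M. \<lambda>w \<in> carrier ?D. u (\<beta> w)"
      let ?\<theta> = "\<lambda>u \<in> points ?P. \<chi> (?\<beta> u)"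
      have "?\<beta> \<in> mor \<Sigma> ?P (dual_space \<sigma> M Mt ?D)"
        using dual_alg_oper_closed[OF strZ] by (intro mor_dual[OF _ algP \<beta>]) (simp add: carD)
      from mor_compose[OF strP this \<chi>] show "?\<theta> \<in> mor \<Sigma> ?P Z" .
      fix i x assume i: "i \<in> {1..n}" and x: "x \<in> points ?A"
      have ix: "?\<iota> i x \<in> hom \<sigma> P M" using morD(6)[OF \<iota>[OF i] x] by simp
      have z: "\<psi> i x \<in> points Z" by (rule morD(6)[OF \<psi>[OF i] x])
      have "?\<beta> (?\<iota> i x) = (\<lambda>w \<in> mor \<Sigma> Z Mt. ?\<iota> i x (\<beta> w))" using ix by (simp add: carD)
      also have "\<dots> = eval_space \<Sigma> Mt Z (\<psi> i x)"
        using x z \<beta>0 i by (auto simp: eval_space_def \<beta>_def)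
      finally have "\<chi> (?\<beta> (?\<iota> i x)) = \<psi> i x" by (simp only: \<chi>ev[OF z])
      then show "?\<theta> (?\<iota> i x) = \<psi> i x" using ix by simp
    qed
  next
    fix \<theta> \<theta>'
    assume "\<theta> \<in> mor \<Sigma> ?P Z \<and> (\<forall>i \<in> {1..n}. \<forall>x \<in> points ?A. \<theta> (?\<iota> i x) = \<psi> i x)"
      and "\<theta>' \<in> mor \<Sigma> ?P Z \<and> (\<forall>i \<in> {1..n}. \<forall>x \<in> points ?A. \<theta>' (?\<iota> i x) = \<psi> i x)"
    then have \<theta>: "\<theta> \<in> mor \<Sigma> ?P Z" "\<theta>' \<in> mor \<Sigma> ?P Z"
      and eq: "\<And>i x. i \<in> {1..n} \<Longrightarrow> x \<in> hom \<sigma> A M \<Longrightarrow> \<theta> (?\<iota> i x) = \<theta>' (?\<iota> i x)" by auto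
    show "\<theta> = \<theta>'"
    proof (rule PiE_ext[OF morD(1)[OF \<theta>(1)] morD(1)[OF \<theta>(2)]])
      fix q assume q: "q \<in> points ?P"
      show "\<theta> q = \<theta>' q"
      proof (rule sepZ)
        show "\<theta> q \<in> points Z" "\<theta>' q \<in> points Z" 
          using morD(6)[OF \<theta>(1) q] morD(6)[OF \<theta>(2) q] by auto
        fix w assume w: "w \<in> mor \<Sigma> Z Mt"
        obtain p p' where p: "p \<in> carrier P" "\<And>u. u \<in> hom \<sigma> P M \<Longrightarrow> w (\<theta> u) = u p"
          and p': "p' \<in> carrier P" "\<And>u. u \<in> hom \<sigma> P M \<Longrightarrow> w (\<theta>' u) = u p'"
          using surjP[OF mor_compose[OF strP \<theta>(1) w]] surjP[OF mor_compose[OF strP \<theta>(2) w]]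
          by auto
        \<comment> \<open>Agreement of \<open>\<theta>\<close> and \<open>\<theta>'\<close> on the
          images of the coprojections means that no \<open>u\<close> tells \<open>pr i p\<close>
          from \<open>pr i p'\<close>.\<close>
        have "p = p'"
        proof (rule eqP[OF p(1) p'(1)])
          fix i u assume i: "i \<in> {1..n}" and u: "u \<in> hom \<sigma> A M"
          have "?\<iota> i u \<in> hom \<sigma> P M" using morD(6)[OF \<iota>[OF i]] u by simp
          then have "?\<iota> i u p = ?\<iota> i u p'" using p(2) p'(2) eq[OF i u] by metis
          then show "u (pr i p) = u (pr i p')" using u p(1) p'(1) by simp
        qed
        then show "w (\<theta> q) = w (\<theta>' q)" using p(2) p'(2) q by simp
      qed
    qed
  qed
qed

text \<open>The points of the dual of \<open>P\<close> are the homomorphisms into \<open>M\<close>,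
  and a direct union is covered by the images of its coprojections, the \<open>i\<close>-th of which
  sends \<open>v\<close> to v o pr i.\<close>

lemma hom_product_factors:
  fixes A P :: "('u, 'f) alg" and pr :: "nat \<Rightarrow> 'u \<Rightarrow> 'u"
  assumes dual: "logarithmic_duality TYPE('u) \<sigma> M \<Sigma> Mt" and "n \<ge> 1"
    and A: "in_ISP \<sigma> M A" and P: "algebra \<sigma> P"
    and pr: "\<And>i. i \<in> {1..n} \<Longrightarrow> pr i \<in> hom \<sigma> P A"
    and surj: "\<And>t. t \<in> {1..n} \<rightarrow> carrier A \<Longrightarrow> \<exists>p \<in> carrier P. \<forall>i \<in> {1..n}. pr i p = t i"
    and inj: "\<And>p q. p \<in> carrier P \<Longrightarrow> q \<in> carrier P \<Longrightarrow>
      (\<And>i. i \<in> {1..n} \<Longrightarrow> pr i p = pr i q) \<Longrightarrow> p = q"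
    and u: "u \<in> hom \<sigma> P M"
  shows "\<exists>i \<in> {1..n}. \<exists>v. \<forall>p \<in> carrier P. u p = v (pr i p)"
proof -
  \<comment> \<open>Composites of the \<open>pr i\<close> with homomorphisms from \<open>A\<close>
    to \<open>M\<close> separate the points of \<open>P\<close>.\<close>
  have "in_ISP \<sigma> M P"
  proof (rule in_ISP_if_separates[OF P], rule inj)
    fix p q i assume pq: "p \<in> carrier P" "q \<in> carrier P" and i: "i \<in> {1..n}"
      and eq: "\<And>u. u \<in> hom \<sigma> P M \<Longrightarrow> u p = u q"
    show "pr i p = pr i q"
    proof (rule in_ISP_separates[OF A])
      show "pr i p \<in> carrier A" "pr i q \<in> carrier A" using hom_closed[OF pr[OF i]] pq by auto
      fix v assume "v \<in> hom \<sigma> A M"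
      from eq[OF hom_compose[OF algebra_opers[OF P] pr[OF i] this]]
      show "v (pr i p) = v (pr i q)" using pq by simp
    qed
  qed
  moreover have "dual_equivalence TYPE('u) \<sigma> M \<Sigma> Mt"
    using dual by (simp add: logarithmic_duality_def)
  ultimately have cop: "is_coproduct \<Sigma> Mt n (\<lambda>_. dual_space \<sigma> M Mt A) (dual_space \<sigma> M Mt P)
      (\<lambda>i. \<lambda>u \<in> hom \<sigma> A M. \<lambda>p \<in> carrier P. u (pr i p))"
    by (intro is_coproduct_dual_product[OF _ A _ pr surj inj])
  have "is_direct_union \<Sigma> n (\<lambda>_. dual_space \<sigma> M Mt A) (dual_space \<sigma> M Mt P)
      (\<lambda>i. \<lambda>u \<in> hom \<sigma> A M. \<lambda>p \<in> carrier P. u (pr i p))"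
    using in_ISP_dual_dual_space[OF A] cop \<open>n \<ge> 1\<close>
    by (intro dual[unfolded logarithmic_duality_def, THEN conjunct2, THEN conjunct2, THEN conjunct2,
          THEN conjunct2, rule_format]) simp_all
  then have "hom \<sigma> P M =
      (\<Union>i \<in> {1..n}. (\<lambda>u \<in> hom \<sigma> A M. \<lambda>p \<in> carrier P. u (pr i p)) ` hom \<sigma> A M)"
    by (simp add: is_direct_union_def)
  then obtain i v where "i \<in> {1..n}" "v \<in> hom \<sigma> A M" "u = (\<lambda>p \<in> carrier P. v (pr i p))"
    using u by auto
  then show ?thesis by auto
qed

text \<open>The power is replaced by a copy \<open>P\<close> on the universe type, to which the
  duality applies. No form of \<open>v\<close> is recorded: constant tuples determine it on
  \<open>carrier A\<close>.\<close>

lemma hom_power_factors: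
  fixes A :: "('u, 'f) alg" and n :: nat
  assumes "infinite (UNIV :: 'u set)" and dual: "logarithmic_duality TYPE('u) \<sigma> M \<Sigma> Mt"
    and "n \<ge> 1" and A: "in_ISP \<sigma> M A" and u: "u \<in> hom \<sigma> (alg_power A {1..n}) M"
  shows "\<exists>i \<in> {1..n}. \<exists>v. \<forall>a \<in> {1..n} \<rightarrow>\<^sub>E carrier A. u a = v (a i)"
proof -
  \<comment> \<open>This keeps \<open>{1..n}\<close> from being rewritten to
    \<open>{Suc 0..n}\<close>.\<close>
  note One_nat_def [simp del]
  let ?C = "{1..n} \<rightarrow>\<^sub>E carrier A"
  have algA: "algebra \<sigma> A" using A by (rule in_ISP_algebra)
  have carC: "carrier (alg_power A {1..n}) = ?C" by (simp add: alg_power_def)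
  have algC: "oper (alg_power A {1..n}) s ts \<in> ?C" if s: "\<sigma> s = Some k" and "ts \<in> tuples k ?C" for s k ts
    using algebra_oper[OF algebra_alg_power[OF algA, of "{1..n}"] s] that(2) unfolding carC by blast
  obtain j :: "(nat \<Rightarrow> 'u) \<Rightarrow> 'u" where j: "inj_on j ?C"
    using ex_inj_on_PiE_atLeastAtMost[OF assms(1)] by blast
  let ?k = "inv_into ?C j"
  \<comment> \<open>The operations are transported along \<open>j\<close>: decode, apply the
    operation of the power, encode.\<close>
  define P where "P = \<lparr>carrier = j ` ?C, oper = (\<lambda>s ps. j (oper (alg_power A {1..n}) s (map ?k ps)))\<rparr>"
  have kC: "?k p \<in> ?C" if "p \<in> carrier P" for p using that by (simp add: P_def inv_into_into)
  have tup: "map ?k ps \<in> tuples m ?C" if "ps \<in> tuples m (carrier P)" for ps m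
    using that kC by (auto simp: tuples_def)
  have kop: "?k (oper P s ps) = oper (alg_power A {1..n}) s (map ?k ps)"
    if "\<sigma> s = Some m" "ps \<in> tuples m (carrier P)" for s m ps
    using inv_into_f_f[OF j algC[OF that(1) tup[OF that(2)]]] by (simp add: P_def)
  have algP: "algebra \<sigma> P"
    using algC tup algA by (auto simp: algebra_def P_def PiE_eq_empty_iff)
  have k: "restrict ?k (carrier P) \<in> hom \<sigma> P (alg_power A {1..n})"
  proof (rule homI)
    show "restrict ?k (carrier P) \<in> carrier P \<rightarrow>\<^sub>E carrier (alg_power A {1..n})"
      unfolding carC using kC by simp
  next
    fix s m ps assume s: "\<sigma> s = Some m" and ps: "ps \<in> tuples m (carrier P)"
    have "map (restrict ?k (carrier P)) ps = map ?k ps" using ps by (auto simp: tuples_def)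
    then show "restrict ?k (carrier P) (oper P s ps) =
        oper (alg_power A {1..n}) s (map (restrict ?k (carrier P)) ps)"
      using kop[OF s ps] algebra_oper[OF algP s ps] by (simp del: map_eq_conv)
  qed
  have proj: "(\<lambda>t \<in> ?C. t i) \<in> hom \<sigma> (alg_power A {1..n}) A" if i: "i \<in> {1..n}" for i
  proof (rule homI)
    show "(\<lambda>t \<in> ?C. t i) \<in> carrier (alg_power A {1..n}) \<rightarrow>\<^sub>E carrier A"
      unfolding carC by (auto intro: PiE_mem[OF _ i])
  next
    fix s m ts assume s: "\<sigma> s = Some m" and "ts \<in> tuples m (carrier (alg_power A {1..n}))"
    then have ts: "ts \<in> tuples m ?C" by (simp add: carC)
    have "map (\<lambda>t \<in> ?C. t i) ts = map (\<lambda>t. t i) ts" using ts by (auto simp: tuples_def)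
    moreover have "(\<lambda>t \<in> ?C. t i) (oper (alg_power A {1..n}) s ts) = oper (alg_power A {1..n}) s ts i"
      using algC[OF s ts] by simp
    ultimately show "(\<lambda>t \<in> ?C. t i) (oper (alg_power A {1..n}) s ts) = oper A s (map (\<lambda>t \<in> ?C. t i) ts)"
      using i by (simp add: alg_power_def del: map_eq_conv)
  qed
  have "\<exists>i \<in> {1..n}. \<exists>v. \<forall>p \<in> carrier P. (\<lambda>p \<in> carrier P. u (restrict ?k (carrier P) p)) p =
      v ((\<lambda>p \<in> carrier P. (\<lambda>t \<in> ?C. t i) (restrict ?k (carrier P) p)) p)"
  proof (rule hom_product_factors[OF dual \<open>n \<ge> 1\<close> A algP])
    show "(\<lambda>p \<in> carrier P. (\<lambda>t \<in> ?C. t i) (restrict ?k (carrier P) p)) \<in> hom \<sigma> P A" if "i \<in> {1..n}" for i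
      by (rule hom_compose[OF algebra_opers[OF algP] k proj[OF that]])
    show "(\<lambda>p \<in> carrier P. u (restrict ?k (carrier P) p)) \<in> hom \<sigma> P M"
      by (rule hom_compose[OF algebra_opers[OF algP] k u])
    show "\<exists>p \<in> carrier P. \<forall>i \<in> {1..n}. (\<lambda>p \<in> carrier P. (\<lambda>t \<in> ?C. t i) (restrict ?k (carrier P) p)) p = t i"
      if "t \<in> {1..n} \<rightarrow> carrier A" for t
    proof (rule bexI[of _ "j (restrict t {1..n})"])
      have t: "restrict t {1..n} \<in> ?C" using that by auto
      then show "j (restrict t {1..n}) \<in> carrier P" by (simp add: P_def)
      then show "\<forall>i \<in> {1..n}. (\<lambda>p \<in> carrier P. (\<lambda>t \<in> ?C. t i) (restrict ?k (carrier P) p)) (j (restrict t {1..n})) = t i"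
        using t inv_into_f_f[OF j t] by simp
    qed
    show "p = q" if pq: "p \<in> carrier P" "q \<in> carrier P"
      and eq: "\<And>i. i \<in> {1..n} \<Longrightarrow> (\<lambda>p \<in> carrier P. (\<lambda>t \<in> ?C. t i) (restrict ?k (carrier P) p)) p =
        (\<lambda>p \<in> carrier P. (\<lambda>t \<in> ?C. t i) (restrict ?k (carrier P) p)) q" for p q
    proof -
      have "?k p = ?k q"
        using eq pq kC by (intro PiE_ext[OF kC kC]) auto
      then show ?thesis using pq by (auto simp: P_def dest: inv_into_injective)
    qed
  qed
  then obtain i v where i: "i \<in> {1..n}" and v: "\<And>p. p \<in> carrier P \<Longrightarrow> u (?k p) = v (?k p i)"
    using kC by auto
  have "u a = v (a i)" if "a \<in> ?C" for a
    using v[of "j a"] inv_into_f_f[OF j that] that by (simp add: P_def)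
  then show ?thesis using i by blast
qed

end

section \<open>Reading off coordinates\<close>

definition diag :: "('a, 'b) func \<Rightarrow> 'a \<Rightarrow> 'b" where
  "diag F x = snd F (\<lambda>i \<in> {1..fst F}. x)"

text \<open>Asking that \<open>u\<close> composed with \<open>F\<close> factor through the
  \<open>i\<close>-th projection by some \<open>v\<close> would say the same, since constant tuples
  force \<open>v\<close> to be \<open>u\<close> composed with \<open>diag F\<close> on
  \<open>C\<close>. The form with \<open>diag\<close> is the convenient one because minors keep the
  diagonal.\<close>

definition reads :: "'a set \<Rightarrow> ('a, 'b) func \<Rightarrow> ('b \<Rightarrow> 'm) \<Rightarrow> nat \<Rightarrow> bool" where
  "reads C F u i \<longleftrightarrow> i \<in> {1..fst F} \<and>
     (\<forall>a \<in> {1..fst F} \<rightarrow>\<^sub>E C. u (snd F a) = u (diag F (a i)))"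

lemma fst_minor [simp]: "fst (minor C m \<tau> F) = m"
  by (simp add: minor_def)

lemma snd_minor: "a \<in> {1..m} \<rightarrow>\<^sub>E C \<Longrightarrow> snd (minor C m \<tau> F) a = snd F (\<lambda>i \<in> {1..fst F}. a (\<tau> i))"
  by (simp add: minor_def)

lemma diag_minor:
  assumes "\<tau> \<in> {1..fst F} \<rightarrow> {1..m}" "x \<in> C"
  shows "diag (minor C m \<tau> F) x = diag F x"
proof -
  have "(\<lambda>i \<in> {1..fst F}. (\<lambda>i \<in> {1..m}. x) (\<tau> i)) = (\<lambda>i \<in> {1..fst F}. x)"
    using assms(1) by (intro restrict_ext) (auto simp: Pi_iff)
  moreover have "(\<lambda>i \<in> {1..m}. x) \<in> {1..m} \<rightarrow>\<^sub>E C" using assms(2) by auto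
  ultimately show ?thesis by (simp only: diag_def snd_minor fst_minor)
qed

text \<open>The minor feeds its argument \<open>\<tau> i\<close> into place \<open>i\<close> of
  \<open>F\<close> and has the same diagonal.\<close>

lemma reads_minor:
  assumes \<tau>: "\<tau> \<in> {1..fst F} \<rightarrow> {1..m}" and F: "reads C F u i"
  shows "reads C (minor C m \<tau> F) u (\<tau> i)"
  unfolding reads_def fst_minor
proof (intro conjI ballI)
  have i: "i \<in> {1..fst F}" using F by (simp add: reads_def)
  then show \<tau>i: "\<tau> i \<in> {1..m}" using \<tau> by auto
  fix a assume a: "a \<in> {1..m} \<rightarrow>\<^sub>E C"
  have "(\<lambda>i \<in> {1..fst F}. a (\<tau> i)) \<in> {1..fst F} \<rightarrow>\<^sub>E C" using a \<tau> by (auto simp: Pi_iff PiE_iff)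
  then have "u (snd F (\<lambda>i \<in> {1..fst F}. a (\<tau> i))) = u (diag F (a (\<tau> i)))"
    using F i unfolding reads_def by (metis restrict_apply')
  moreover have "a (\<tau> i) \<in> C" using a \<tau>i by (rule PiE_mem)
  ultimately show "u (snd (minor C m \<tau> F) a) = u (diag (minor C m \<tau> F) (a (\<tau> i)))"
    by (simp only: snd_minor[OF a] diag_minor[OF \<tau>])
qed

text \<open>A tuple with \<open>x\<close> at \<open>i\<close> and \<open>y\<close> elsewhere tells
  the two coordinates apart. If \<open>u\<close> is constant on the diagonal, one readable
  coordinate makes all of them readable, which is why \<open>x\<close> and \<open>y\<close> are
  supplied.\<close>

lemma reads_unique:
  assumes "reads C F u i" "reads C F u j" "x \<in> C" "y \<in> C" "u (diag F x) \<noteq> u (diag F y)"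
  shows "i = j"
proof (rule ccontr)
  assume "i \<noteq> j"
  let ?a = "\<lambda>k \<in> {1..fst F}. if k = i then x else y"
  have "?a \<in> {1..fst F} \<rightarrow>\<^sub>E C" using assms(3,4) by auto
  then have "u (diag F (?a i)) = u (diag F (?a j))" using assms(1,2) unfolding reads_def by metis
  then show False using assms \<open>i \<noteq> j\<close> by (auto simp: reads_def)
qed

section \<open>Invariants of minors, and the cards of a deck\<close>

lemma is_minorE:
  assumes "is_minor C G F"
  obtains \<tau> where "\<tau> \<in> {1..fst F} \<rightarrow> {1..fst G}" "G = minor C (fst G) \<tau> F"
  using assms by (auto simp: is_minor_def)

lemma diag_is_minor:
  assumes "is_minor C G F" "x \<in> C"
  shows "diag G x = diag F x"
  using assms by (metis is_minorE diag_minor)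

text \<open>Having a common coordinate is thus shared by equivalent functions, so it can be tested
  on any representative of a card.\<close>

lemma reads_both_is_minor:
  assumes "is_minor C G F" "\<exists>i. reads C F u i \<and> reads C F v i"
  shows "\<exists>i. reads C G u i \<and> reads C G v i"
  using assms by (metis is_minorE reads_minor)

lemma delta_funcset:
  assumes "I \<subseteq> {1..n}" "card I = 2"
  shows "delta I \<in> {1..n} \<rightarrow> {1..n - 1}"
proof -
  obtain p q where I: "I = {p, q}" "p < q"
    using assms(2) by (metis card_2_iff insert_commute linorder_neqE_nat)
  then show ?thesis using assms(1) by (auto simp: delta_def max_def min_def)
qed

lemma delta_pair_eq: "i \<noteq> k \<Longrightarrow> delta {i, k} l = delta {i, k} i \<Longrightarrow> l \<in> {i, k}"
  by (auto simp: delta_def max_def min_def split: if_splits)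

lemma funcs_PiE: "F \<in> funcs C D \<Longrightarrow> snd F \<in> ({1..fst F} \<rightarrow>\<^sub>E C) \<rightarrow>\<^sub>E D"
  by (simp add: funcs_def split_beta)

lemma minor_in_funcs:
  assumes "F \<in> funcs C D" "m \<ge> 1" "\<tau> \<in> {1..fst F} \<rightarrow> {1..m}"
  shows "minor C m \<tau> F \<in> funcs C D"
proof -
  have \<tau>: "(\<lambda>i \<in> {1..fst F}. a (\<tau> i)) \<in> {1..fst F} \<rightarrow>\<^sub>E C" if "a \<in> {1..m} \<rightarrow>\<^sub>E C" for a
    using that assms(3) by (auto simp: Pi_iff PiE_iff)
  have f: "snd F \<in> ({1..fst F} \<rightarrow>\<^sub>E C) \<rightarrow>\<^sub>E D" by (rule funcs_PiE[OF assms(1)])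
  show ?thesis using assms(2) PiE_mem[OF f \<tau>] by (simp add: funcs_def minor_def)
qed

lemma func_equiv_refl:
  assumes "F \<in> funcs C D"
  shows "func_equiv C F F"
proof -
  obtain n f where F: "F = (n, f)" "f \<in> ({1..n} \<rightarrow>\<^sub>E C) \<rightarrow>\<^sub>E D" using assms by (auto simp: funcs_def)
  have "minor C n (\<lambda>i. i) F = (n, \<lambda>a \<in> {1..n} \<rightarrow>\<^sub>E C. f a)"
    by (auto simp: minor_def F(1) intro!: restrict_ext arg_cong[where f = f] PiE_restrict)
  then have "is_minor C F F"
    using F by (auto simp: is_minor_def PiE_restrict intro!: bexI[of _ "\<lambda>i. i"])
  then show ?thesis by (simp add: func_equiv_def)
qed

text \<open>Decks are compared one card at a time: a class occurring in one occurs in the other, and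
  since a card belongs to its own class, equal classes give equivalent functions.\<close>

lemma card_in_equal_deck:
  assumes F: "F \<in> funcs C D" and n: "fst F \<ge> 2" and deck: "deck C D F = deck C D G"
    and I: "I \<subseteq> {1..fst F}" "card I = 2"
  obtains J where "J \<subseteq> {1..fst G}" "card J = 2"
    "func_equiv C (minor C (fst F - 1) (delta I) F) (minor C (fst G - 1) (delta J) G)"
proof -
  have fin: "finite {I. I \<subseteq> {1..m} \<and> card I = 2}" for m :: nat
    by (rule finite_subset[of _ "Pow {1..m}"]) auto
  let ?F = "minor C (fst F - 1) (delta I) F"
  have "func_class C D ?F \<in># deck C D F"
    using I fin unfolding deck_def by auto
  then have "func_class C D ?F \<in># deck C D G" using deck by simp
  then obtain J where J: "J \<subseteq> {1..fst G}" "card J = 2"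
    "func_class C D ?F = func_class C D (minor C (fst G - 1) (delta J) G)"
    using fin unfolding deck_def by auto
  \<comment> \<open>Arity at least 2 leaves the card a positive arity, as \<open>funcs\<close>
    demands.\<close>
  have "?F \<in> funcs C D"
    using n by (intro minor_in_funcs F delta_funcset I) auto
  then have "?F \<in> func_class C D ?F" by (simp add: func_class_def func_equiv_refl)
  then show thesis using J that by (auto simp: func_class_def)
qed

section \<open>Recovering the function from its deck\<close>

text \<open>If \<open>i\<close> and \<open>i'\<close> differed, \<open>u\<close> and
  \<open>v\<close> would read different coordinates in some card of \<open>F\<close>, whereas they
  keep a common one in every card of \<open>G\<close>; such a card of \<open>F\<close> has no
  counterpart among those of \<open>G\<close>.\<close>

lemma reads_both_if_equal_deck:
  assumes F: "F \<in> funcs C D" and n: "fst F \<ge> 3" and deck: "deck C D F = deck C D G"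
    and u: "reads C F u i" "x \<in> C" "y \<in> C" "u (diag F x) \<noteq> u (diag F y)"
    and v: "reads C F v i'" "x' \<in> C" "y' \<in> C" "v (diag F x') \<noteq> v (diag F y')"
    and both: "\<exists>j. reads C G u j \<and> reads C G v j"
  shows "i' = i"
proof (rule ccontr)
  assume "i' \<noteq> i"
  \<comment> \<open>Three arguments leave an index \<open>k\<close> outside \<open>{i, i'}\<close>;
    merging \<open>i\<close> with \<open>k\<close> keeps \<open>i'\<close> apart from
    \<open>i\<close>.\<close>
  have "\<not> {1..fst F} \<subseteq> {i, i'}"
    using n card_mono[of "{i, i'}" "{1..fst F}"] card_insert_le_m1[of 2 "{i'}" i] by auto
  then obtain k where k: "k \<in> {1..fst F}" "k \<noteq> i" "k \<noteq> i'" by blast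
  let ?I = "{i, k}"
  have I: "?I \<subseteq> {1..fst F}" "card ?I = 2" using k u(1) by (auto simp: reads_def)
  let ?F = "minor C (fst F - 1) (delta ?I) F"
  obtain J where J: "J \<subseteq> {1..fst G}" "card J = 2"
    and eq: "func_equiv C ?F (minor C (fst G - 1) (delta J) G)"
    using card_in_equal_deck[OF F _ deck I] n by auto
  have \<delta>: "delta ?I \<in> {1..fst F} \<rightarrow> {1..fst F - 1}" by (rule delta_funcset[OF I])
  obtain j where "reads C G u j" "reads C G v j" using both by blast
  from this[THEN reads_minor[OF delta_funcset[OF J]]]
  have "\<exists>j. reads C (minor C (fst G - 1) (delta J) G) u j \<and>
      reads C (minor C (fst G - 1) (delta J) G) v j"
    by blast
  then obtain j where j: "reads C ?F u j" "reads C ?F v j"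
    using reads_both_is_minor[of C ?F] eq unfolding func_equiv_def by blast
  have "u (diag ?F x) \<noteq> u (diag ?F y)" "v (diag ?F x') \<noteq> v (diag ?F y')"
    using u(2-4) v(2-4) diag_minor[OF \<delta>] by simp_all
  then have "delta ?I i = j" "delta ?I i' = j"
    using reads_unique[OF reads_minor[OF \<delta> u(1)] j(1) u(2,3)]
      reads_unique[OF reads_minor[OF \<delta> v(1)] j(2) v(2,3)] by simp_all
  then have "i' \<in> ?I" using k(2) delta_pair_eq[of i k i'] by simp
  then show False using \<open>i' \<noteq> i\<close> k(3) by auto
qed

text \<open>\<open>H\<close> stands for the homomorphisms from \<open>B\<close> to \<open>M\<close>.
  The substitution \<open>\<tau>\<close> sends the coordinate that \<open>u\<close> reads in
  \<open>F\<close> to the one it reads in \<open>G\<close>; then no member of \<open>H\<close>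
  distinguishes \<open>G\<close> from the minor of \<open>F\<close> along \<open>\<tau>\<close>, and
  \<open>H\<close> separates points.\<close>

lemma is_minor_if_equal_deck:
  fixes H :: "('b \<Rightarrow> 'm) set" and C :: "'a set" and D :: "'b set"
  assumes F: "F \<in> funcs C D" and G: "G \<in> funcs C D"
    and n: "fst F = fst G" "fst F \<ge> 3" and deck: "deck C D F = deck C D G"
    and readsF: "\<And>u. u \<in> H \<Longrightarrow> \<exists>i. reads C F u i"
    and readsG: "\<And>u. u \<in> H \<Longrightarrow> \<exists>i. reads C G u i"
    and sep: "\<And>b c. b \<in> D \<Longrightarrow> c \<in> D \<Longrightarrow> (\<And>u. u \<in> H \<Longrightarrow> u b = u c) \<Longrightarrow> b = c"
  shows "is_minor C G F"
proof -
  \<comment> \<open>As minors keep the diagonal, one card is enough to see that \<open>F\<close> and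
    \<open>G\<close> have the same one; the pair \<open>{1, 2}\<close> is an arbitrary
    choice.\<close>
  have "{1, 2} \<subseteq> {1..fst F}" "card {1, 2 :: nat} = 2" using n by auto
  from card_in_equal_deck[OF F _ deck this] n obtain J where J: "J \<subseteq> {1..fst G}" "card J = 2"
    and eq: "func_equiv C (minor C (fst F - 1) (delta {1, 2}) F) (minor C (fst G - 1) (delta J) G)"
    by auto
  have diag: "diag F x = diag G x" if "x \<in> C" for x
    using diag_is_minor[of C _ _ x] eq that diag_minor[OF delta_funcset[OF J] that]
      diag_minor[OF delta_funcset[OF \<open>{1, 2} \<subseteq> {1..fst F}\<close> \<open>card {1, 2} = 2\<close>] that]
    unfolding func_equiv_def by metis
  \<comment> \<open>For these maps the coordinate read is unique, so they are the ones that
    determine \<open>\<tau>\<close>.\<close>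
  define NC where "NC = {u \<in> H. \<exists>x \<in> C. \<exists>y \<in> C. u (diag F x) \<noteq> u (diag F y)}"
  have NC_G: "\<exists>x \<in> C. \<exists>y \<in> C. u (diag G x) \<noteq> u (diag G y)" if "u \<in> NC" for u
    using that diag by (auto simp: NC_def)
  have uniqG: "i = j" if "u \<in> NC" "reads C G u i" "reads C G u j" for u i j
    using NC_G[OF that(1)] reads_unique[OF that(2,3)] by blast
  \<comment> \<open>Maps sharing a coordinate in \<open>F\<close> share one in \<open>G\<close>,
    which makes \<open>\<tau>\<close> well defined. The preceding lemma is applied with
    \<open>F\<close> and \<open>G\<close> exchanged.\<close>
  have same: "i = j" if "u \<in> NC" "v \<in> NC" "reads C F u k" "reads C F v k" "reads C G u i" "reads C G v j"
    for u v k i j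
  proof -
    obtain x y where xy: "x \<in> C" "y \<in> C" "u (diag G x) \<noteq> u (diag G y)" using NC_G \<open>u \<in> NC\<close> by blast
    obtain x' y' where xy': "x' \<in> C" "y' \<in> C" "v (diag G x') \<noteq> v (diag G y')" using NC_G \<open>v \<in> NC\<close> by blast
    show ?thesis
      using reads_both_if_equal_deck[OF G _ deck[symmetric] that(5) xy that(6) xy'] n that(3,4)
      by auto
  qed
  \<comment> \<open>Coordinates read by no map in \<open>NC\<close> go to the default 1; any value
    in range would do.\<close>
  define \<tau> where "\<tau> k = (if \<exists>u \<in> NC. reads C F u k
    then SOME j. \<exists>u \<in> NC. reads C F u k \<and> reads C G u j else 1)" for k
  have \<tau>: "reads C G u (\<tau> k)" if u: "u \<in> NC" "reads C F u k" for u k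
  proof -
    obtain i where i: "reads C G u i" using readsG u by (auto simp: NC_def)
    then have ex: "\<exists>j. \<exists>u \<in> NC. reads C F u k \<and> reads C G u j" using u by blast
    then have "\<exists>v \<in> NC. reads C F v k \<and> reads C G v (\<tau> k)"
      using someI_ex[OF ex] u unfolding \<tau>_def by auto
    then show ?thesis using same u i by metis
  qed
  have \<tau>n: "\<tau> \<in> {1..fst F} \<rightarrow> {1..fst G}"
  proof
    fix k
    show "\<tau> k \<in> {1..fst G}"
    proof (cases "\<exists>u \<in> NC. reads C F u k")
      case True
      then show ?thesis using \<tau> by (auto simp: reads_def)
    next
      case False
      then have "\<tau> k = 1" unfolding \<tau>_def by simp
      then show ?thesis using n by auto
    qed
  qed
  let ?F = "minor C (fst G) \<tau> F"
  have memF: "?F \<in> funcs C D" using n by (intro minor_in_funcs F \<tau>n) auto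
  have "snd G a = snd ?F a" if a: "a \<in> {1..fst G} \<rightarrow>\<^sub>E C" for a
  proof (rule sep)
    show "snd G a \<in> D" "snd ?F a \<in> D" 
      using PiE_mem[OF funcs_PiE[OF G] a] PiE_mem[OF funcs_PiE[OF memF]] a by simp_all
    fix u assume u: "u \<in> H"
    obtain i j where i: "reads C F u i" and j: "reads C G u j" using readsF[OF u] readsG[OF u] by blast
    have i': "reads C ?F u (\<tau> i)" by (rule reads_minor[OF \<tau>n i])
    then have ti: "\<tau> i \<in> {1..fst G}" by (simp add: reads_def)
    then have C: "a (\<tau> i) \<in> C" using a by (rule PiE_mem[rotated])
    have "u (snd ?F a) = u (diag ?F (a (\<tau> i)))" using i' a by (simp add: reads_def)
    also have "\<dots> = u (diag F (a (\<tau> i)))" using diag_minor[OF \<tau>n C] by simp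
    also have "\<dots> = u (snd G a)"
    proof (cases "u \<in> NC")
      case True
      then have "u (snd G a) = u (diag G (a (\<tau> i)))" using \<tau>[OF _ i] a by (simp add: reads_def)
      then show ?thesis using diag[OF C] by simp
    next
      case False
      \<comment> \<open>Here \<open>u\<close> is constant on the diagonal, so it does not matter
        that \<open>j\<close> and \<open>\<tau> i\<close> may differ.\<close>
      have j': "j \<in> {1..fst G}" "u (snd G a) = u (diag G (a j))" using j a by (auto simp: reads_def)
      have aj: "a j \<in> C" by (rule PiE_mem[OF a j'(1)])
      then have "u (diag F (a (\<tau> i))) = u (diag F (a j))" using False C u unfolding NC_def by blast
      then show ?thesis by (simp only: j'(2) diag[OF aj])
    qed
    finally show "u (snd G a) = u (snd ?F a)" by simp
  qed
  then have "snd G = snd ?F"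
    using funcs_PiE[OF memF] by (intro PiE_ext[OF funcs_PiE[OF G]]) simp_all
  then have "G = ?F" by (intro prod_eqI) auto
  then show ?thesis using \<tau>n unfolding is_minor_def by blast
qed

section \<open>Homomorphisms out of finite powers read coordinates, and so are determined by their
  decks\<close>

theorem theorem4p6:
  fixes \<sigma> :: "'f signature" and M :: "('m, 'f) alg"
    and \<Sigma> :: "('g, 'h, 'r) tsignature" and Mt :: "('m, 'g, 'h, 'r) tstruct"
    and A :: "('u, 'f) alg" and B :: "('u, 'f) alg"
  assumes "infinite (UNIV :: 'u set)"
    and "algebra \<sigma> M" and "finite (carrier M)"
    and "alter_ego \<sigma> M \<Sigma> Mt"
    and "logarithmic_duality TYPE('u) \<sigma> M \<Sigma> Mt"
    and "in_ISP \<sigma> M A" and "in_ISP \<sigma> M B"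
  shows "weakly_reconstructible (carrier A) (carrier B)
           {F \<in> hom_funcs \<sigma> A B. ess (carrier A) F > 2}"
proof -
  interpret alter_ego_setting \<sigma> M \<Sigma> Mt
    by unfold_locales (fact assms)+
  let ?C = "carrier A" and ?D = "carrier B"
  have algA: "algebra \<sigma> A" using assms(6) by (rule in_ISP_algebra)
  have funcs: "F \<in> funcs ?C ?D" if "F \<in> hom_funcs \<sigma> A B" for F
    using that unfolding hom_funcs_def funcs_def hom_def alg_power_def by auto
  have read: "\<exists>i. reads ?C F u i" if F': "F \<in> hom_funcs \<sigma> A B" and u: "u \<in> hom \<sigma> B M" for F u
  proof -
    obtain n f where F: "F = (n, f)" "n \<ge> 1" and f: "f \<in> hom \<sigma> (alg_power A {1..n}) B"
      using F' by (auto simp: hom_funcs_def)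
    let ?P = "{1..n} \<rightarrow>\<^sub>E ?C"
    have car: "carrier (alg_power A {1..n}) = ?P" by (simp add: alg_power_def)
    have "(\<lambda>a \<in> carrier (alg_power A {1..n}). u (f a)) \<in> hom \<sigma> (alg_power A {1..n}) M"
      by (rule hom_compose[OF algebra_opers[OF algebra_alg_power[OF algA]] f u])
    from hom_power_factors[OF assms(1,5) F(2) assms(6) this]
    obtain i v where i: "i \<in> {1..n}" and v: "\<And>a. a \<in> ?P \<Longrightarrow> u (f a) = v (a i)"
      unfolding car by auto
    \<comment> \<open>The constant tuple with entry \<open>a i\<close> agrees with \<open>a\<close>
      at \<open>i\<close>, so both give \<open>v (a i)\<close>; this replaces \<open>v\<close> by
      \<open>u\<close> composed with the diagonal.\<close>
    have "u (f a) = u (f (\<lambda>k \<in> {1..n}. a i))" if a: "a \<in> ?P" for a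
    proof -
      have "(\<lambda>k \<in> {1..n}. a i) \<in> ?P" using PiE_mem[OF a i] by (simp del: One_nat_def)
      from v[OF this] v[OF a] show ?thesis using i by simp
    qed
    then show ?thesis using i by (auto simp: reads_def diag_def F(1) simp del: One_nat_def)
  qed
  show ?thesis
    unfolding weakly_reconstructible_def
  proof (intro ballI impI)
    fix F G
    assume "F \<in> {F \<in> hom_funcs \<sigma> A B. ess ?C F > 2}" "G \<in> {F \<in> hom_funcs \<sigma> A B. ess ?C F > 2}"
      and FG: "fst G = fst F \<and> deck ?C ?D G = deck ?C ?D F"
    then have F: "F \<in> hom_funcs \<sigma> A B" and G: "G \<in> hom_funcs \<sigma> A B" and ess: "ess ?C F > 2" by auto
    \<comment> \<open>Essential arity above 2 forces at least three arguments, which the choice of a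
      third index calls for.\<close>
    have "ess ?C F \<le> card {1..fst F}"
      unfolding ess_def by (rule card_mono) auto
    then have n: "fst F \<ge> 3" "fst G \<ge> 3" using ess FG by auto
    have arity: "fst F = fst G" and deck: "deck ?C ?D F = deck ?C ?D G" using FG by simp_all
    note sep = in_ISP_separates[OF assms(7)]
    show "func_equiv ?C G F"
      unfolding func_equiv_def
    proof
      show "is_minor ?C G F"
        by (rule is_minor_if_equal_deck[OF funcs[OF F] funcs[OF G] arity n(1) deck
              read[OF F] read[OF G] sep])
      show "is_minor ?C F G"
        by (rule is_minor_if_equal_deck[OF funcs[OF G] funcs[OF F] arity[symmetric] n(2) deck[symmetric]
              read[OF G] read[OF F] sep])
    qed
  qed
qed

end
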